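(* For a uniform space $X$ with uniformity $\mathcal U(X)$ the following conditions are equivalent: (1) the free locally convex space $\mathsf L_u(X)$ has a local $\mathfrak G$-base; (2) the uniformity $\mathcal U(X)$ has a $\mathfrak G$-base and the poset $C_u(X)$ is $\omega^\omega$-dominated; (3) the uniformity $\mathcal U(X)$ has a $\mathfrak G$-base and $C_u(X)$ is $\omega^\omega$-dominated in $\mathbb R^X$.
   Context: Uniform spaces are separated. $\omega^\omega$ is the set of all functions $\omega\to\omega$ with the coordinatewise partial order. A topological space has a local $\mathfrak G$-base if every point has a neighborhood base $(U_\alpha)_{\alpha\in\omega^\omega}$ with $U_\beta\subset U_\alpha$ whenever $\alpha\le\beta$. A uniformity has a $\mathfrak G$-base if it has a base of entourages $(U_\alpha)_{\alpha\in\omega^\omega}$ with $U_\beta\subset U_\alpha$ whenever $\alpha\le\beta$. $C_u(X)\subset\mathbb R^X$ is the set of uniformly continuous real-valued functions on $X$, with the pointwise partial order inherited from $\mathbb R^X$. $C_u(X)$ is $\omega^\omega$-dominated (resp. $\omega^\omega$-dominated in $\mathbb R^X$) if there is a family $(f_\alpha)_{\alpha\in\omega^\omega}$ in $C_u(X)$ (resp. in $\mathbb R^X$) with $f_\alpha\le f_\beta$ for $\alpha\le\beta$ and such that every $f\in C_u(X)$ satisfies $f\le f_\alpha$ for some $\alpha\in\omega^\omega$. Topological vector spaces are real and Hausdorff and carry their natural (translation-invariant) uniformity. The free locally convex space of a uniform space $X$ is a pair $(\mathsf L_u(X),\delta_X)$ of a locally convex space and a uniformly continuous map $\delta_X:X\to\mathsf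 L_u(X)$ such that for every uniformly continuous map $f:X\to Y$ into a locally convex space $Y$ there is a unique continuous linear operator $\bar f:\mathsf L_u(X)\to Y$ with $\bar f\circ\delta_X=f$. *)

theory Defs
  imports "HOL-Analysis.Analysis" "HOL-Library.Function_Algebras"
begin

section \<open>Bases and domination indexed by functions on the natural numbers\<close>

text \<open>
  The index poset is \<^typ>\<open>nat \<Rightarrow> nat\<close> with the coordinatewise order.  The first definition is used
  both for neighbourhood filters and for the filter of entourages of a uniformity.
\<close>

definition has_G_base :: "'p filter \<Rightarrow> bool" where
  "has_G_base F \<longleftrightarrow>
     (\<exists>U :: (nat \<Rightarrow> nat) \<Rightarrow> 'p set.
        (\<forall>\<alpha>. \<forall>\<^sub>F p in F. p \<in> U \<alpha>) \<and>
        (\<forall>P. eventually P F \<longrightarrow> (\<exists>\<alpha>. \<forall>p\<in>U \<alpha>. P p)) \<and>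
        (\<forall>\<alpha> \<beta>. \<alpha> \<le> \<beta> \<longrightarrow> U \<beta> \<subseteq> U \<alpha>))"

definition has_local_G_base :: "'p topology \<Rightarrow> bool" where
  "has_local_G_base T \<longleftrightarrow> (\<forall>p\<in>topspace T. has_G_base (nhdsin T p))"

definition omega_dominated_in :: "'p::order set \<Rightarrow> 'p set \<Rightarrow> bool" where
  "omega_dominated_in A B \<longleftrightarrow>
     (\<exists>\<phi> :: (nat \<Rightarrow> nat) \<Rightarrow> 'p.
        (\<forall>\<alpha>. \<phi> \<alpha> \<in> B) \<and>
        (\<forall>\<alpha> \<beta>. \<alpha> \<le> \<beta> \<longrightarrow> \<phi> \<alpha> \<le> \<phi> \<beta>) \<and>
        (\<forall>f\<in>A. \<exists>\<alpha>. f \<le> \<phi> \<alpha>))"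

abbreviation omega_dominated :: "'p::order set \<Rightarrow> bool" where
  "omega_dominated A \<equiv> omega_dominated_in A A"

definition C_u :: "('a::uniform_space \<Rightarrow> real) set" where
  "C_u = {f. uniformly_continuous_on UNIV f}"


section \<open>Locally convex spaces\<close>

text \<open>
  A locally convex space is given by its topology; the underlying vector space is \<^term>\<open>topspace T\<close>,
  a linear subspace of the ambient type.  Spaces are real and Hausdorff.
\<close>

definition topological_vector_space :: "'v::real_vector topology \<Rightarrow> bool" where
  "topological_vector_space T \<longleftrightarrow>
     subspace (topspace T) \<and>
     Hausdorff_space T \<and>
     continuous_map (prod_topology T T) T (\<lambda>(u, v). u + v) \<and>
     continuous_map (prod_topology euclideanreal T) T (\<lambda>(c, v). c *\<^sub>R v)"

definition locally_convex_space :: "'v::real_vector topology \<Rightarrow> bool" where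
  "locally_convex_space T \<longleftrightarrow>
     topological_vector_space T \<and>
     (\<forall>U. openin T U \<and> 0 \<in> U \<longrightarrow> (\<exists>V. openin T V \<and> 0 \<in> V \<and> convex V \<and> V \<subseteq> U))"

text \<open>The natural, translation-invariant uniformity of a topological vector space.\<close>

definition tvs_uniformity :: "'v::real_vector topology \<Rightarrow> ('v \<times> 'v) filter" where
  "tvs_uniformity T =
     (INF W\<in>{W. openin T W \<and> 0 \<in> W}.
        principal {(u, v). u \<in> topspace T \<and> v \<in> topspace T \<and> v - u \<in> W})"

definition uniformly_continuous_into ::
    "'v::real_vector topology \<Rightarrow> ('a::uniform_space \<Rightarrow> 'v) \<Rightarrow> bool" where
  "uniformly_continuous_into T f \<longleftrightarrow>
     range f \<subseteq> topspace T \<and>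
     (LIM (x, y) uniformity. (f x, f y) :> tvs_uniformity T)"


section \<open>Free locally convex spaces\<close>

text \<open>
  The universal property with respect to all locally convex spaces whose underlying vector space is a
  subspace of the type \<open>'y\<close>.  It presupposes \<^prop>\<open>topspace L = UNIV\<close>, so that linear operators on
  \<open>L\<close> are total linear maps.
\<close>

definition universal_for ::
    "'y::real_vector itself \<Rightarrow> 'l::real_vector topology \<Rightarrow> ('a::uniform_space \<Rightarrow> 'l) \<Rightarrow> bool" where
  "universal_for _ L \<delta> \<longleftrightarrow>
     (\<forall>(Y :: 'y topology) f. locally_convex_space Y \<and> uniformly_continuous_into Y f \<longrightarrow>
        (\<exists>!g. linear g \<and> continuous_map L Y g \<and> g \<circ> \<delta> = f))"

instantiation "fun" :: (type, real_vector) real_vector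
begin

definition scaleR_fun :: "real \<Rightarrow> ('a \<Rightarrow> 'b) \<Rightarrow> 'a \<Rightarrow> 'b" where
  "scaleR_fun c f = (\<lambda>x. c *\<^sub>R f x)"

instance
  by standard (simp_all add: scaleR_fun_def plus_fun_def algebra_simps)

end

text \<open>
  HOL cannot quantify over all types inside a definition.  The universal property is therefore
  required for target spaces inside two types only: that of \<open>L\<close> and \<^typ>\<open>'a \<Rightarrow> real\<close>.  By lemma
  \<open>free_lcs_universal\<close> below, this implies the universal property for target spaces inside every
  type, so nothing is lost.
\<close>

definition free_locally_convex_space ::
    "'l::real_vector topology \<Rightarrow> ('a::uniform_space \<Rightarrow> 'l) \<Rightarrow> bool" where
  "free_locally_convex_space L \<delta> \<longleftrightarrow>
     locally_convex_space L \<and> topspace L = UNIV \<and>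
     uniformly_continuous_into L \<delta> \<and>
     universal_for TYPE('l) L \<delta> \<and>
     universal_for TYPE('a \<Rightarrow> real) L \<delta>"

lemma eventually_tvs_uniformity:
  assumes "openin T W" "0 \<in> W"
  shows "eventually (\<lambda>(u, v). u \<in> topspace T \<and> v \<in> topspace T \<and> v - u \<in> W) (tvs_uniformity T)"
  unfolding tvs_uniformity_def
  by (rule eventually_INF1[of W]) (use assms in \<open>auto simp: eventually_principal\<close>)

lemma uniformly_continuous_into_iff:
  "uniformly_continuous_into T f \<longleftrightarrow> range f \<subseteq> topspace T \<and>
     (\<forall>W. openin T W \<and> 0 \<in> W \<longrightarrow> eventually (\<lambda>(x, y). f y - f x \<in> W) uniformity)"
    (is "?L \<longleftrightarrow> ?R")
proof
  assume L: ?L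
  then have r: "range f \<subseteq> topspace T"
    and lim: "LIM p uniformity. (case p of (x, y) \<Rightarrow> (f x, f y)) :> tvs_uniformity T"
    unfolding uniformly_continuous_into_def by (auto simp: case_prod_unfold)
  have "eventually (\<lambda>(x, y). f y - f x \<in> W) uniformity" if "openin T W" "0 \<in> W" for W
    using filterlim_iff[THEN iffD1, OF lim, rule_format, OF eventually_tvs_uniformity[OF that]]
    by (rule eventually_mono) auto
  with r show ?R by blast
next
  assume R: ?R
  then show ?L
    unfolding uniformly_continuous_into_def tvs_uniformity_def
    by (auto simp: filterlim_INF filterlim_principal case_prod_unfold range_subsetD)
qed

lemma locally_convex_space_pullback:
  fixes Z :: "'z::real_vector topology" and k :: "'y::real_vector \<Rightarrow> 'z"
  assumes Z: "locally_convex_space Z" and S: "subspace S" and k: "linear k" "inj_on k S"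
    and kS: "k ` S \<subseteq> topspace Z"
  shows "locally_convex_space (pullback_topology S k Z)"
proof -
  let ?T = "pullback_topology S k Z"
  have ts: "topspace ?T = S"
    using kS by (auto simp: topspace_pullback_topology)
  have kc: "continuous_map ?T Z k"
    using continuous_map_pullback[OF continuous_map_id, of S k Z] by (simp add: comp_def)
  have into: "continuous_map X ?T g" if "continuous_map X Z (k \<circ> g)" "g \<in> topspace X \<rightarrow> S"
    for X :: "'q topology" and g
    by (rule continuous_map_pullback') (use that in auto)
  have "Hausdorff_space ?T"
    unfolding Hausdorff_space_def
  proof safe
    fix x y assume xy: "x \<in> topspace ?T" "y \<in> topspace ?T" "x \<noteq> y"
    then have "k x \<noteq> k y" "k x \<in> topspace Z" "k y \<in> topspace Z"
      using k kS ts by (auto dest: inj_onD)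
    then obtain U V where UV: "openin Z U" "openin Z V" "k x \<in> U" "k y \<in> V" "disjnt U V"
      using Z unfolding locally_convex_space_def topological_vector_space_def Hausdorff_space_def
      by metis
    then show "\<exists>U V. openin ?T U \<and> openin ?T V \<and> x \<in> U \<and> y \<in> V \<and> disjnt U V"
      using xy ts
      by (intro exI[of _ "k -` U \<inter> S"] exI[of _ "k -` V \<inter> S"])
        (auto simp: openin_pullback_topology disjnt_def)
  qed
  moreover have "continuous_map (prod_topology ?T ?T) ?T (\<lambda>(u, v). u + v)"
  proof (rule into)
    have "continuous_map (prod_topology ?T ?T) (prod_topology Z Z) (\<lambda>p. (k (fst p), k (snd p)))"
      using continuous_map_compose[OF continuous_map_fst kc]
        continuous_map_compose[OF continuous_map_snd kc]
      by (intro continuous_map_pairedI) (simp_all add: comp_def)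
    moreover have "continuous_map (prod_topology Z Z) Z (\<lambda>(u, v). u + v)"
      using Z by (simp add: locally_convex_space_def topological_vector_space_def)
    ultimately have "continuous_map (prod_topology ?T ?T) Z
        ((\<lambda>(u, v). u + v) \<circ> (\<lambda>p. (k (fst p), k (snd p))))"
      by (rule continuous_map_compose)
    moreover have "(\<lambda>(u, v). u + v) \<circ> (\<lambda>p. (k (fst p), k (snd p))) = k \<circ> (\<lambda>(u, v). u + v)"
      using k by (auto simp: fun_eq_iff linear_add)
    ultimately show "continuous_map (prod_topology ?T ?T) Z (k \<circ> (\<lambda>(u, v). u + v))"
      by (simp only:)
    show "(\<lambda>(u, v). u + v) \<in> topspace (prod_topology ?T ?T) \<rightarrow> S"
      unfolding topspace_prod_topology ts using S by (auto intro: subspace_add)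
  qed
  moreover have "continuous_map (prod_topology euclideanreal ?T) ?T (\<lambda>(c, v). c *\<^sub>R v)"
  proof (rule into)
    have "continuous_map (prod_topology euclideanreal ?T) (prod_topology euclideanreal Z)
        (\<lambda>p. (fst p, k (snd p)))"
      using continuous_map_compose[OF continuous_map_snd kc]
      by (intro continuous_map_pairedI) (simp_all add: comp_def continuous_map_fst)
    moreover have "continuous_map (prod_topology euclideanreal Z) Z (\<lambda>(c, v). c *\<^sub>R v)"
      using Z by (simp add: locally_convex_space_def topological_vector_space_def)
    ultimately have "continuous_map (prod_topology euclideanreal ?T) Z
        ((\<lambda>(c, v). c *\<^sub>R v) \<circ> (\<lambda>p. (fst p, k (snd p))))"
      by (rule continuous_map_compose)
    moreover have "(\<lambda>(c, v). c *\<^sub>R v) \<circ> (\<lambda>p. (fst p, k (snd p))) = k \<circ> (\<lambda>(c, v). c *\<^sub>R v)"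
      using k by (auto simp: fun_eq_iff linear_scale)
    ultimately show "continuous_map (prod_topology euclideanreal ?T) Z (k \<circ> (\<lambda>(c, v). c *\<^sub>R v))"
      by (simp only:)
    show "(\<lambda>(c, v). c *\<^sub>R v) \<in> topspace (prod_topology euclideanreal ?T) \<rightarrow> S"
      unfolding topspace_prod_topology ts using S by (auto intro: subspace_scale)
  qed
  moreover have "\<exists>V. openin ?T V \<and> 0 \<in> V \<and> convex V \<and> V \<subseteq> U"
    if "openin ?T U" "0 \<in> U" for U
  proof -
    obtain U' where U': "openin Z U'" "U = k -` U' \<inter> S"
      using \<open>openin ?T U\<close> by (auto simp: openin_pullback_topology)
    moreover have "0 \<in> U'"
      using U' \<open>0 \<in> U\<close> linear_0[OF k(1)] by auto
    ultimately obtain V where "openin Z V" "0 \<in> V" "convex V" "V \<subseteq> U'"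
      using Z unfolding locally_convex_space_def by blast
    moreover from this have "convex (k -` V \<inter> S)"
      using S k(1) by (simp add: convex_Int convex_linear_vimage subspace_imp_convex)
    ultimately show ?thesis
      using U' S linear_0[OF k(1)]
      by (intro exI[of _ "k -` V \<inter> S"]) (auto simp: openin_pullback_topology subspace_0)
  qed
  ultimately show ?thesis
    using S ts by (simp add: locally_convex_space_def topological_vector_space_def)
qed

lemma uniformly_continuous_into_pullback:
  assumes "uniformly_continuous_into Z (k \<circ> h)" "linear k" "range h \<subseteq> S" "subspace S"
  shows "uniformly_continuous_into (pullback_topology S k Z) h"
  unfolding uniformly_continuous_into_iff
proof safe
  fix x show "h x \<in> topspace (pullback_topology S k Z)"
    using assms by (auto simp: topspace_pullback_topology uniformly_continuous_into_iff)
next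
  fix W assume "openin (pullback_topology S k Z) W" "0 \<in> W"
  then obtain U where U: "openin Z U" "W = k -` U \<inter> S" "0 \<in> U"
    using linear_0[OF assms(2)] by (auto simp: openin_pullback_topology)
  then have "eventually (\<lambda>(x, y). (k \<circ> h) y - (k \<circ> h) x \<in> U) uniformity"
    using assms(1) unfolding uniformly_continuous_into_iff by blast
  then show "eventually (\<lambda>(x, y). h y - h x \<in> W) uniformity"
    by (rule eventually_mono)
      (use U assms in \<open>auto simp: linear_diff intro!: subspace_diff\<close>)
qed

lemma free_lcs_span:
  fixes L :: "'l::real_vector topology" and \<delta> :: "'a::uniform_space \<Rightarrow> 'l"
  assumes "free_locally_convex_space L \<delta>"
  shows "span (range \<delta>) = UNIV"
proof -
  let ?S = "span (range \<delta>)"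
  let ?T = "pullback_topology ?S id L"
  from assms have L: "locally_convex_space L" "topspace L = UNIV"
    "uniformly_continuous_into L \<delta>" "universal_for TYPE('l) L \<delta>"
    by (auto simp: free_locally_convex_space_def)
  have id: "linear (id :: 'l \<Rightarrow> 'l)"
    by (rule linear_id)
  have "locally_convex_space ?T"
    by (rule locally_convex_space_pullback) (use L id in auto)
  moreover have "uniformly_continuous_into ?T \<delta>"
    by (rule uniformly_continuous_into_pullback) (use L id in \<open>auto simp: span_base\<close>)
  ultimately obtain g where g: "linear g" "continuous_map L ?T g" "g \<circ> \<delta> = \<delta>"
    using L(4) unfolding universal_for_def by blast
  have "continuous_map ?T L id"
    using continuous_map_pullback[OF continuous_map_id, of ?S id L] by simp
  with g(2) have "continuous_map L L (id \<circ> g)"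
    by (rule continuous_map_compose)
  moreover have "\<exists>!h. linear h \<and> continuous_map L L h \<and> h \<circ> \<delta> = \<delta>"
    using L unfolding universal_for_def by blast
  ultimately have "g = id"
    using g id by (metis continuous_map_id id_comp)
  then show ?thesis
    using g(2) L(2) by (auto simp: continuous_map_def topspace_pullback_topology)
qed

lemma free_lcs_universal:
  fixes L :: "'l::real_vector topology" and \<delta> :: "'a::uniform_space \<Rightarrow> 'l"
  assumes free: "free_locally_convex_space L \<delta>"
  shows "universal_for TYPE('z::real_vector) L \<delta>"
  unfolding universal_for_def
proof (intro allI impI ex_ex1I; elim conjE)
  fix Z :: "'z topology" and f :: "'a \<Rightarrow> 'z"
  assume Z: "locally_convex_space Z" and f: "uniformly_continuous_into Z f"
  from Z have subZ: "subspace (topspace Z)"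
    by (simp add: locally_convex_space_def topological_vector_space_def)
  obtain B where B: "B \<subseteq> range f" "independent B" "range f \<subseteq> span B"
    using maximal_independent_subset[of "range f"] by blast
  define e where "e b = (\<lambda>x. if x = inv f b then 1 else 0 :: real)" for b
  have finv: "f (inv f b) = b" if "b \<in> B" for b
    using that B by (meson f_inv_into_f subsetD)
  have inj_e: "inj_on e B"
    by (rule inj_onI) (metis e_def finv zero_neq_one)
  have sum_apply: "(\<Sum>v\<in>A. u v *\<^sub>R v) x = (\<Sum>v\<in>A. u v * v x)"
    for A :: "('a \<Rightarrow> real) set" and u x
    by (induction A rule: infinite_finite_induct) (auto simp: scaleR_fun_def)
  have ind: "independent (e ` B)"
    unfolding independent_explicit_module
  proof (intro allI impI)
    fix t u v
    assume t: "finite t" "t \<subseteq> e ` B" and s: "(\<Sum>v\<in>t. u v *\<^sub>R v) = 0" and v: "v \<in> t"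
    then obtain b where b: "b \<in> B" "v = e b" by auto
    have eval: "w (inv f b) = (if w = v then 1 else 0)" if "w \<in> t" for w
    proof -
      obtain c where c: "c \<in> B" "w = e c" using \<open>w \<in> t\<close> t by blast
      have "inv f b = inv f c \<longleftrightarrow> b = c" using b c finv by metis
      moreover have "w = v \<longleftrightarrow> c = b" using b c inj_e by (auto dest: inj_onD)
      ultimately show ?thesis by (auto simp: c e_def)
    qed
    have "(\<Sum>w\<in>t. u w * w (inv f b)) = (\<Sum>w\<in>t. if w = v then u w else 0)"
    proof (intro sum.cong refl)
      fix w assume "w \<in> t"
      then show "u w * w (inv f b) = (if w = v then u w else 0)"
        using eval[of w] by simp
    qed
    also have "\<dots> = u v"
      using t v by simp
    finally show "u v = 0"
      using fun_cong[OF s, of "inv f b"] by (simp add: sum_apply)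
  qed
  obtain k :: "('a \<Rightarrow> real) \<Rightarrow> 'z" where k: "linear k" "\<forall>x\<in>e ` B. k x = inv_into B e x"
    using linear_independent_extend[OF ind] by blast
  have ke: "k (e b) = b" if "b \<in> B" for b
    using that k inj_e by simp
  have kB: "k ` e ` B = B"
    using ke by force
  define S where "S = span (e ` B)"
  have S: "subspace S" by (simp add: S_def)
  have kS: "k ` S = span B"
    unfolding S_def using kB linear_span_image[OF k(1)] by metis
  have inj: "inj_on k S"
    unfolding S_def
  proof (rule linear_inj_on_span_independent_image[OF k(1)])
    show "independent (k ` e ` B)" using B kB by simp
    show "inj_on k (e ` B)" using ke by (auto intro!: inj_onI)
  qed
  have BZ: "span B \<subseteq> topspace Z"
    using B(1) f subZ by (intro span_minimal) (auto simp: uniformly_continuous_into_iff)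
  have "\<exists>s. s \<in> S \<and> k s = f x" for x
  proof -
    have "f x \<in> k ` S" using B(3) kS by blast
    then show ?thesis by (elim imageE) auto
  qed
  then obtain h where h: "\<And>x. h x \<in> S" "\<And>x. k (h x) = f x"
    by metis
  then have kh: "k \<circ> h = f" by auto
  let ?T = "pullback_topology S k Z"
  have "locally_convex_space ?T"
    by (rule locally_convex_space_pullback) (use Z S k inj kS BZ in auto)
  moreover have "uniformly_continuous_into ?T h"
    by (rule uniformly_continuous_into_pullback) (use f kh k h S in auto)
  ultimately obtain g where g: "linear g" "continuous_map L ?T g" "g \<circ> \<delta> = h"
    using free unfolding free_locally_convex_space_def universal_for_def by blast
  have "continuous_map ?T Z k"
    using continuous_map_pullback[OF continuous_map_id, of S k Z] by simp
  then have "continuous_map L Z (k \<circ> g)"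
    by (rule continuous_map_compose[OF g(2)])
  moreover have "linear (k \<circ> g)"
    by (rule linear_compose[OF g(1) k(1)])
  moreover have "(k \<circ> g) \<circ> \<delta> = f"
    using g(3) kh by (simp add: comp_assoc)
  ultimately show "\<exists>g. linear g \<and> continuous_map L Z g \<and> g \<circ> \<delta> = f"
    by (intro exI[of _ "k \<circ> g"] conjI)
next
  fix f :: "'a \<Rightarrow> 'z" and g1 g2 :: "'l \<Rightarrow> 'z"
  assume g: "linear g1" "linear g2" and eq: "g1 \<circ> \<delta> = f" "g2 \<circ> \<delta> = f"
  have "g1 (\<delta> x) = g2 (\<delta> x)" for x
    using fun_cong[OF trans[OF eq(1) eq(2)[symmetric]], of x] by simp
  then have "g1 v = g2 v" if "v \<in> span (range \<delta>)" for v
    by (intro linear_eq_on_span[OF g _ that]) auto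
  then show "g1 = g2"
    using free_lcs_span[OF free] by auto
qed

end

theory Submission
  imports Defs
begin

text \<open>
  The topology of the free locally convex space \<open>L\<close> is the finest locally convex topology for which
  \<open>\<delta>\<close> is uniformly continuous.  Consequently a disc \<open>W\<close> (an absolutely convex absorbing set) is a
  neighbourhood of zero as soon as the pairs \<open>(x, y)\<close> with \<open>r (\<delta> y - \<delta> x) \<in> W\<close> form an entourage for
  every \<open>r > 0\<close> (\<open>free_lcs_disc_neighbourhood\<close>).  A neighbourhood of zero is thus described by two
  kinds of data: a sequence of entourages, which controls the differences of generators, and a
  real function, which controls the size of the generators.  The theorem says that these data can be
  indexed by functions on the natural numbers exactly when the neighbourhoods can.

  From a local base to domination: the preimages of the basic neighbourhoods \<open>U \<alpha>\<close> under
  \<open>(x, y) \<mapsto> \<delta> y - \<delta> x\<close> are a base of the uniformity, because every entourage comes from a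
  pseudometric and hence from a uniformly continuous map into a Banach space, which extends to \<open>L\<close>
  (\<open>free_lcs_entourage\<close>).  The support functions \<open>x \<mapsto> sup {g (\<delta> x) | g \<le> 1 on U \<alpha>}\<close> of the polars are
  uniformly continuous and dominate \<open>C_u\<close>, because every function in \<open>C_u\<close> extends to a continuous
  functional, which is bounded by 1 on some \<open>U \<alpha>\<close>.

  From domination to a local base: given entourages \<open>V \<alpha>\<close> and arbitrary dominating functions \<open>\<phi> \<alpha>\<close>,
  the disc hulls (\<open>disc_hull\<close>) of a sequence of the former and one of the latter are neighbourhoods
  of zero.  They form a base: for a disc neighbourhood \<open>D\<close> the function \<open>x \<mapsto> p (\<delta> x) + 1\<close>, with
  \<open>p\<close> the Minkowski functional of \<open>D\<close>, is uniformly continuous and so lies below some \<open>\<phi> \<alpha>\<close>.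
  A sequence of indices is coded by one index through a pairing function.

  Since the second step uses domination by arbitrary real functions and the first yields
  domination by uniformly continuous ones, both forms of domination are equivalent to the existence
  of a local base.
\<close>

section \<open>Uniformly continuous pseudometrics\<close>

text \<open>
  The cut is made at the entry where the accumulated weight first reaches \<open>c\<close>.  If the weights are
  nonnegative with total below \<open>2 * c\<close>, then the parts on both sides of this entry weigh less than \<open>c\<close>.
\<close>

lemma split_list_at_weight:
  fixes w :: "'s \<Rightarrow> real"
  assumes "p \<noteq> []" "0 < c"
  shows "\<exists>p1 s p2. p = p1 @ s # p2 \<and> sum_list (map w p1) < c \<and>
           (p2 = [] \<or> c \<le> sum_list (map w p1) + w s)"
  using assms
proof (induction p arbitrary: c)
  case (Cons s p)
  show ?case
  proof (cases "c \<le> w s \<or> p = []")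
    case True
    then show ?thesis
      using Cons.prems by (intro exI[of _ "[]"] exI[of _ s] exI[of _ p]) auto
  next
    case False
    then obtain p1 t p2 where "p = p1 @ t # p2" "sum_list (map w p1) < c - w s"
      "p2 = [] \<or> c - w s \<le> sum_list (map w p1) + w t"
      using Cons.IH[of "c - w s"] by auto
    then show ?thesis
      by (intro exI[of _ "s # p1"] exI[of _ t] exI[of _ p2]) auto
  qed
qed simp

text \<open>
  A path from \<open>x\<close> is given by its later vertices, each labelled with the index of an entourage that
  contains the step leading to it.  A step with label \<open>k\<close> has length \<open>2\<^sup>-\<^sup>k\<close>.
\<close>

fun entourage_path :: "(nat \<Rightarrow> ('a \<times> 'a) set) \<Rightarrow> 'a \<Rightarrow> (nat \<times> 'a) list \<Rightarrow> 'a \<Rightarrow> bool" where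
  "entourage_path E x [] z \<longleftrightarrow> x = z"
| "entourage_path E x ((k, y) # p) z \<longleftrightarrow> (x, y) \<in> E k \<and> entourage_path E y p z"

definition path_length :: "(nat \<times> 'a) list \<Rightarrow> real" where
  "path_length p = sum_list (map (\<lambda>s. (1/2) ^ fst s) p)"

lemma path_length_simps [simp]:
  "path_length [] = 0"
  "path_length (s # p) = (1/2) ^ fst s + path_length p"
  "path_length (p @ q) = path_length p + path_length q"
  by (simp_all add: path_length_def)

lemma path_length_nonneg: "0 \<le> path_length p"
  by (induction p) auto

lemma entourage_path_append:
  "entourage_path E x (p @ q) z \<longleftrightarrow> (\<exists>y. entourage_path E x p y \<and> entourage_path E y q z)"
  by (induction p arbitrary: x) auto

text \<open>
  A path shorter than \<open>2\<^sup>-\<^sup>n\<close> is cut into two paths shorter than \<open>2\<^sup>-\<^sup>n\<^sup>-\<^sup>1\<close> and one step with label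
  above \<open>n\<close>; by induction on the number of steps each of the three pieces stays in \<open>E (Suc n)\<close>.
\<close>

lemma short_entourage_path:
  assumes refl: "\<And>k x. (x, x) \<in> E k"
    and triple: "\<And>k x y z u. (x, y) \<in> E (Suc k) \<Longrightarrow> (y, z) \<in> E (Suc k) \<Longrightarrow> (z, u) \<in> E (Suc k)
                   \<Longrightarrow> (x, u) \<in> E k"
    and "entourage_path E x p z" "path_length p < (1/2) ^ n"
  shows "(x, z) \<in> E n"
  using assms(3,4)
proof (induction "length p" arbitrary: p x z n rule: less_induct)
  case less
  have "E (Suc k) \<subseteq> E k" for k
    using triple[OF refl refl] by auto
  then have dec: "E m \<subseteq> E k" if "k \<le> m" for k m
    using that by (rule lift_Suc_antimono_le)
  show ?case
  proof (cases "p = []")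
    case True
    then show ?thesis using less.prems refl by simp
  next
    case False
    let ?c = "(1/2) ^ Suc n :: real"
    obtain p1 s p2 where p: "p = p1 @ s # p2" and p1: "path_length p1 < ?c"
      and cut: "p2 = [] \<or> ?c \<le> path_length p1 + (1/2) ^ fst s"
      using split_list_at_weight[OF False, of ?c "\<lambda>s. (1/2) ^ fst s"]
      by (auto simp: path_length_def)
    have p2: "path_length p2 < ?c"
      using cut less.prems(2) p by auto
    have "(1/2) ^ fst s < (1/2 :: real) ^ n"
      using less.prems(2) path_length_nonneg[of p1] path_length_nonneg[of p2]
      unfolding p path_length_simps by linarith
    then have "n < fst s"
      by simp
    obtain y where y: "entourage_path E x p1 y" "(y, snd s) \<in> E (fst s)"
      "entourage_path E (snd s) p2 z"
      using less.prems(1) p by (cases s) (auto simp: entourage_path_append)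
    have "(x, y) \<in> E (Suc n)" "(snd s, z) \<in> E (Suc n)"
      by (rule less.hyps[OF _ y(1) p1], simp add: p, rule less.hyps[OF _ y(3) p2], simp add: p)
    moreover have "(y, snd s) \<in> E (Suc n)"
      using y(2) dec[of "Suc n" "fst s"] \<open>n < fst s\<close> by auto
    ultimately show ?thesis
      using triple by blast
  qed
qed

lemma uniformity_triple:
  fixes D :: "('a::uniform_space \<times> 'a) set"
  assumes "\<forall>\<^sub>F p in uniformity. p \<in> D"
  obtains D' where "\<forall>\<^sub>F p in uniformity. p \<in> D'"
    "\<And>x y z u. (x, y) \<in> D' \<Longrightarrow> (y, z) \<in> D' \<Longrightarrow> (z, u) \<in> D' \<Longrightarrow> (x, u) \<in> D"
proof -
  obtain P where P: "eventually P uniformity" "\<And>x y z. P (x, y) \<Longrightarrow> P (y, z) \<Longrightarrow> (x, z) \<in> D"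
    using uniformity_transE[OF assms] by blast
  obtain Q where Q: "eventually Q uniformity" "\<And>x y z. Q (x, y) \<Longrightarrow> Q (y, z) \<Longrightarrow> P (x, z)"
    using uniformity_transE[OF P(1)] by blast
  show ?thesis
  proof (rule that[of "{p. Q p}"])
    fix x y z u
    assume "(x, y) \<in> {p. Q p}" "(y, z) \<in> {p. Q p}" "(z, u) \<in> {p. Q p}"
    moreover from this have "P (z, u)"
      using Q(2)[of z u u] uniformity_refl[OF Q(1)] by simp
    ultimately show "(x, u) \<in> D"
      using P(2) Q(2) by blast
  qed (use Q in simp)
qed

text \<open>
  The metrization argument of Alexandroff and Urysohn: the distance is the infimum of the lengths of
  entourage paths, summed over both directions to make it symmetric.  The whole square serves as
  \<open>E 0\<close>; it connects any two points by a path of length 1 and so makes the distance bounded.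
\<close>

lemma uniform_pseudometric:
  fixes D :: "('a::uniform_space \<times> 'a) set"
  assumes "\<forall>\<^sub>F p in uniformity. p \<in> D"
  obtains d :: "'a \<Rightarrow> 'a \<Rightarrow> real" where
    "\<And>x. d x x = 0" "\<And>x y. 0 \<le> d x y" "\<And>x y. d x y \<le> 2" "\<And>x y. d x y = d y x"
    "\<And>x y z. d x z \<le> d x y + d y z"
    "\<And>e. 0 < e \<Longrightarrow> \<forall>\<^sub>F (x, y) in uniformity. d x y < e"
    "\<And>x y. d x y < 1/2 \<Longrightarrow> (x, y) \<in> D"
proof -
  \<comment> \<open>The construction of \<open>E\<close> starts from the whole square; only from index 1 on does it lie in \<open>D\<close>.\<close>
  have ex: "\<exists>E. \<forall>n. ((\<forall>\<^sub>F p in uniformity. p \<in> E n) \<and> (n = 0 \<longrightarrow> E n = UNIV) \<and> (n = 1 \<longrightarrow> E n \<subseteq> D)) \<and>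
      (\<forall>x y z u. (x, y) \<in> E (Suc n) \<longrightarrow> (y, z) \<in> E (Suc n) \<longrightarrow> (z, u) \<in> E (Suc n) \<longrightarrow> (x, u) \<in> E n)"
  proof (rule dependent_nat_choice)
    fix C :: "('a \<times> 'a) set" and n :: nat
    assume C: "(\<forall>\<^sub>F p in uniformity. p \<in> C) \<and> (n = 0 \<longrightarrow> C = UNIV) \<and> (n = 1 \<longrightarrow> C \<subseteq> D)"
    have "\<forall>\<^sub>F p in uniformity. p \<in> C \<inter> D"
      using C assms by (auto intro: eventually_conj)
    then obtain D' where D': "\<forall>\<^sub>F p in uniformity. p \<in> D'"
      "\<And>x y z u. (x, y) \<in> D' \<Longrightarrow> (y, z) \<in> D' \<Longrightarrow> (z, u) \<in> D' \<Longrightarrow> (x, u) \<in> C \<inter> D"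
      using uniformity_triple by blast
    have refl: "(x, x) \<in> D'" for x
      using uniformity_refl[OF D'(1)] .
    show "\<exists>C'. ((\<forall>\<^sub>F p in uniformity. p \<in> C') \<and> (Suc n = 0 \<longrightarrow> C' = UNIV) \<and>
        (Suc n = 1 \<longrightarrow> C' \<subseteq> D)) \<and>
        (\<forall>x y z u. (x, y) \<in> C' \<longrightarrow> (y, z) \<in> C' \<longrightarrow> (z, u) \<in> C' \<longrightarrow> (x, u) \<in> C)"
    proof (intro exI[of _ D'] conjI impI allI)
      show "\<forall>\<^sub>F p in uniformity. p \<in> D'"
        by (rule D'(1))
      show "D' \<subseteq> D"
        using D'(2)[OF refl refl] by auto
      show "(x, u) \<in> C" if "(x, y) \<in> D'" "(y, z) \<in> D'" "(z, u) \<in> D'" for x y z u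
        using D'(2)[OF that] by simp
    qed simp
  qed auto
  obtain E where
    *: "\<And>n. (\<forall>\<^sub>F p in uniformity. p \<in> E n) \<and> (n = 0 \<longrightarrow> E n = UNIV) \<and> (n = 1 \<longrightarrow> E n \<subseteq> D)"
    and triple: "\<And>n x y z u. (x, y) \<in> E (Suc n) \<Longrightarrow> (y, z) \<in> E (Suc n) \<Longrightarrow> (z, u) \<in> E (Suc n)
                   \<Longrightarrow> (x, u) \<in> E n"
  proof -
    from ex obtain E where E: "\<forall>n. ((\<forall>\<^sub>F p in uniformity. p \<in> E n) \<and> (n = 0 \<longrightarrow> E n = UNIV) \<and>
        (n = 1 \<longrightarrow> E n \<subseteq> D)) \<and>
        (\<forall>x y z u. (x, y) \<in> E (Suc n) \<longrightarrow> (y, z) \<in> E (Suc n) \<longrightarrow> (z, u) \<in> E (Suc n) \<longrightarrow> (x, u) \<in> E n)"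
      by (rule exE)
    show thesis
      by (rule that[OF E[rule_format, THEN conjunct1] E[rule_format, THEN conjunct2, rule_format]])
  qed
  have E: "\<And>n. \<forall>\<^sub>F p in uniformity. p \<in> E n" "E 0 = UNIV" "E 1 \<subseteq> D"
    using * by auto
  have refl: "(x, x) \<in> E k" for k x
    using uniformity_refl[OF E(1)] .
  define q where "q x z = Inf {path_length p |p. entourage_path E x p z}" for x z
  have bdd: "bdd_below {path_length p |p. entourage_path E x p z}" for x z
    using path_length_nonneg by (auto intro!: bdd_belowI[of _ 0])
  have q_le: "q x z \<le> path_length p" if "entourage_path E x p z" for x p z
    unfolding q_def by (rule cInf_lower) (use that bdd in auto)
  have step: "entourage_path E x [(k, y)] y \<and> path_length [(k, y)] = (1/2) ^ k"
    if "(x, y) \<in> E k" for x y k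
    using that by simp
  have ne: "{path_length p |p. entourage_path E x p z} \<noteq> {}" for x z
    using step[of x z 0] E(2) by blast
  have q_less: "\<exists>p. entourage_path E x p z \<and> path_length p < r" if "q x z < r" for x z r
    using that cInf_less_iff[OF ne bdd] unfolding q_def by auto
  have q_nonneg: "0 \<le> q x z" for x z
    unfolding q_def by (rule cInf_greatest[OF ne]) (auto simp: path_length_nonneg)
  have q_refl: "q x x = 0" for x
    using q_le[of x "[]" x] q_nonneg[of x x] by simp
  have q_step: "q x y \<le> (1/2) ^ k" if "(x, y) \<in> E k" for x y k
    using step[OF that] q_le by metis
  have q_triangle: "q x z \<le> q x y + q y z" for x y z
  proof (rule field_le_epsilon)
    fix e :: real assume "0 < e"
    then obtain p1 p2 where "entourage_path E x p1 y" "path_length p1 < q x y + e/2"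
      "entourage_path E y p2 z" "path_length p2 < q y z + e/2"
      using q_less[of x y "q x y + e/2"] q_less[of y z "q y z + e/2"] by auto
    moreover from this have "q x z \<le> path_length (p1 @ p2)"
      by (intro q_le) (auto simp: entourage_path_append)
    ultimately show "q x z \<le> q x y + q y z + e" by simp
  qed
  show ?thesis
  proof (rule that[of "\<lambda>x y. q x y + q y x"])
    fix x y z
    show "q x y + q y x \<le> 2"
      using q_step[of x y 0] q_step[of y x 0] E(2) by simp
    show "q x z + q z x \<le> q x y + q y x + (q y z + q z y)"
      using q_triangle[of x z y] q_triangle[of z x y] by simp
  next
    fix e :: real assume "0 < e"
    then obtain k where k: "(1/2) ^ k < e/2"
      using real_arch_pow_inv[of "e/2" "1/2"] by auto
    have "\<forall>\<^sub>F (x, y) in uniformity. (x, y) \<in> E k \<and> (y, x) \<in> E k"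
      using eventually_conj[OF E(1) uniformity_sym[OF E(1)], of k k]
      by (simp add: case_prod_unfold)
    then show "\<forall>\<^sub>F (x, y) in uniformity. q x y + q y x < e"
    proof (rule eventually_mono, clarify)
      fix x y assume "(x, y) \<in> E k" "(y, x) \<in> E k"
      then show "q x y + q y x < e"
        using q_step[of x y k] q_step[of y x k] k by simp
    qed
  next
    fix x y assume "q x y + q y x < 1/2"
    then have "q x y < 1/2" using q_nonneg[of y x] by simp
    then obtain p where "entourage_path E x p y" "path_length p < (1/2) ^ 1"
      using q_less[of x y "1/2"] by auto
    then have "(x, y) \<in> E 1"
      using short_entourage_path[of E x p y 1] refl triple by blast
    then show "(x, y) \<in> D" using E(3) by auto
  qed (use q_refl q_nonneg in auto)
qed

section \<open>Neighbourhoods of zero in a locally convex space\<close>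

lemma locally_convex_space_euclidean:
  "locally_convex_space (euclidean :: 'v::real_normed_vector topology)"
proof -
  have "\<exists>V. open V \<and> 0 \<in> V \<and> convex V \<and> V \<subseteq> U" if U: "open U" "0 \<in> U" for U :: "'v set"
  proof -
    obtain e where "0 < e" "ball 0 e \<subseteq> U"
      using U open_contains_ball by blast
    then show ?thesis
      by (intro exI[of _ "ball 0 e"]) auto
  qed
  then show ?thesis
    unfolding locally_convex_space_def topological_vector_space_def
    by (auto simp: case_prod_unfold intro!: continuous_intros)
qed

lemma uniformly_continuous_into_euclidean:
  fixes f :: "'a::uniform_space \<Rightarrow> 'v::real_normed_vector"
  assumes "\<And>e. 0 < e \<Longrightarrow> \<forall>\<^sub>F (x, y) in uniformity. norm (f y - f x) < e"
  shows "uniformly_continuous_into euclidean f"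
  unfolding uniformly_continuous_into_iff
proof safe
  fix W :: "'v set" assume "openin euclidean W" "0 \<in> W"
  then obtain e where e: "0 < e" "ball 0 e \<subseteq> W"
    by (auto simp: open_contains_ball)
  show "\<forall>\<^sub>F (x, y) in uniformity. f y - f x \<in> W"
    using assms[OF e(1)] by (rule eventually_mono) (use e(2) in auto)
qed simp

text \<open>A one-sided estimate suffices, because the uniformity is symmetric.\<close>

lemma C_u_I:
  fixes f :: "'a::uniform_space \<Rightarrow> real"
  assumes "\<And>e. 0 < e \<Longrightarrow> \<forall>\<^sub>F (x, y) in uniformity. f y \<le> f x + e"
  shows "f \<in> C_u"
proof -
  have "\<forall>\<^sub>F (x, y) in uniformity. dist (f x) (f y) < e" if "0 < e" for e
  proof -
    have *: "\<forall>\<^sub>F (x, y) in uniformity. f y \<le> f x + e/2"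
      using assms[of "e/2"] that by simp
    show ?thesis
      using * uniformity_sym[OF *]
      by eventually_elim (use that in \<open>auto simp: dist_real_def\<close>)
  qed
  then show ?thesis
    unfolding C_u_def uniformly_continuous_on_uniformity
    by (auto simp: uniformity_dist filterlim_INF filterlim_principal case_prod_unfold)
qed

lemma C_u_D:
  fixes f :: "'a::uniform_space \<Rightarrow> real"
  assumes "f \<in> C_u" "0 < e"
  shows "\<forall>\<^sub>F (x, y) in uniformity. \<bar>f y - f x\<bar> < e"
  using assms uniformly_continuous_onD[of UNIV f "\<lambda>(a, b). dist a b < e"]
  by (auto simp: C_u_def eventually_uniformity_metric dist_real_def abs_minus_commute)

context
  fixes T :: "'v::real_vector topology"
  assumes tvs: "topological_vector_space T" and UNIV: "topspace T = UNIV"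
begin

lemma openin_translate:
  assumes "openin T U" shows "openin T {v. a + v \<in> U}"
proof -
  have "continuous_map T T ((\<lambda>(u, v). u + v) \<circ> (\<lambda>v. (a, v)))"
    by (rule continuous_map_compose[of _ "prod_topology T T"])
      (use tvs UNIV in \<open>auto simp: topological_vector_space_def intro!: continuous_map_pairedI\<close>)
  then show ?thesis
    using openin_continuous_map_preimage[OF _ assms] UNIV by (fastforce simp: comp_def)
qed

lemma openin_scale:
  assumes "openin T U" shows "openin T {v. c *\<^sub>R v \<in> U}"
proof -
  have "continuous_map T T ((\<lambda>(c, v). c *\<^sub>R v) \<circ> (\<lambda>v. (c, v)))"
    by (rule continuous_map_compose[of _ "prod_topology euclideanreal T"])
      (use tvs UNIV in \<open>auto simp: topological_vector_space_def intro!: continuous_map_pairedI\<close>)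
  then show ?thesis
    using openin_continuous_map_preimage[OF _ assms] UNIV by (fastforce simp: comp_def)
qed

lemma openin_absorbing:
  assumes "openin T U" "0 \<in> U"
  shows "\<exists>e>0. e *\<^sub>R v \<in> U"
proof -
  have "continuous_map euclideanreal T ((\<lambda>(c, v). c *\<^sub>R v) \<circ> (\<lambda>c. (c, v)))"
    by (rule continuous_map_compose[of _ "prod_topology euclideanreal T"])
      (use tvs UNIV in \<open>auto simp: topological_vector_space_def intro!: continuous_map_pairedI\<close>)
  then have "openin euclideanreal {c. c *\<^sub>R v \<in> U}"
    using openin_continuous_map_preimage[OF _ assms(1)] by (fastforce simp: comp_def)
  then have "open {c. c *\<^sub>R v \<in> U}" "0 \<in> {c. c *\<^sub>R v \<in> U}"
    using assms by auto
  then obtain e where "0 < e" "ball 0 e \<subseteq> {c. c *\<^sub>R v \<in> U}"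
    using open_contains_ball by blast
  then show ?thesis
    by (intro exI[of _ "e/2"]) (auto simp: subset_eq)
qed

end

text \<open>Convexity and symmetry together express absolute convexity.\<close>

definition disc :: "'v::real_vector set \<Rightarrow> bool" where
  "disc W \<longleftrightarrow> convex W \<and> (\<forall>v\<in>W. - v \<in> W) \<and> (\<forall>v. \<exists>e>0. e *\<^sub>R v \<in> W)"

text \<open>The vector \<open>c v\<close> is the convex combination of \<open>v\<close> and \<open>- v\<close> with weights \<open>(1 + c) / 2\<close> and \<open>(1 - c) / 2\<close>.\<close>

lemma scaleR_mem_symmetric_convex:
  assumes "convex W" "\<And>v. v \<in> W \<Longrightarrow> - v \<in> W" "v \<in> W" "\<bar>c\<bar> \<le> 1"
  shows "c *\<^sub>R v \<in> W"
proof -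
  have "((1 + c) / 2) *\<^sub>R v + ((1 - c) / 2) *\<^sub>R (- v) \<in> W"
    using assms by (intro convexD) (auto simp: field_simps)
  moreover have "((1 + c) / 2) *\<^sub>R v + ((1 - c) / 2) *\<^sub>R (- v) = c *\<^sub>R v"
    by (simp add: field_simps flip: scaleR_minus_left scaleR_left_distrib)
  ultimately show ?thesis by simp
qed

lemma disc_scaleR: "disc W \<Longrightarrow> v \<in> W \<Longrightarrow> \<bar>c\<bar> \<le> 1 \<Longrightarrow> c *\<^sub>R v \<in> W"
  by (rule scaleR_mem_symmetric_convex) (auto simp: disc_def)

lemma disc_zero: "disc W \<Longrightarrow> 0 \<in> W"
  using disc_scaleR[of W _ 0] by (auto simp: disc_def)

lemma disc_add:
  assumes "disc W" "(s + t) *\<^sub>R u \<in> W" "(s + t) *\<^sub>R v \<in> W" "0 < s" "0 < t"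
  shows "s *\<^sub>R u + t *\<^sub>R v \<in> W"
proof -
  have "(s / (s + t)) *\<^sub>R ((s + t) *\<^sub>R u) + (t / (s + t)) *\<^sub>R ((s + t) *\<^sub>R v) \<in> W"
    by (rule convexD) (use assms in \<open>auto simp: disc_def simp flip: add_divide_distrib\<close>)
  then show ?thesis using assms by simp
qed

lemma disc_Int:
  assumes "disc A" "disc B" shows "disc (A \<inter> B)"
proof -
  have "\<exists>e>0. e *\<^sub>R v \<in> A \<inter> B" for v
  proof -
    obtain a b where ab: "0 < a" "a *\<^sub>R v \<in> A" "0 < b" "b *\<^sub>R v \<in> B"
      using assms unfolding disc_def by meson
    have "(min a b / a) *\<^sub>R (a *\<^sub>R v) \<in> A" "(min a b / b) *\<^sub>R (b *\<^sub>R v) \<in> B"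
      using ab disc_scaleR[OF assms(1) ab(2), of "min a b / a"]
        disc_scaleR[OF assms(2) ab(4), of "min a b / b"] by (auto simp: abs_of_pos)
    then have "min a b *\<^sub>R v \<in> A \<inter> B"
      using ab by (simp only: scaleR_scaleR) simp
    then show ?thesis using ab by (intro exI[of _ "min a b"]) auto
  qed
  then show ?thesis
    using assms by (auto simp: disc_def convex_Int)
qed

lemma disc_scaleR_vimage:
  assumes "disc A" shows "disc {v. r *\<^sub>R v \<in> A}"
proof -
  have "convex ((\<lambda>v. r *\<^sub>R v) -` A)"
    using assms by (intro convex_linear_vimage) (auto simp: disc_def linear_iff algebra_simps)
  moreover have "\<exists>e>0. r *\<^sub>R e *\<^sub>R v \<in> A" for v
    using assms unfolding disc_def by (metis scaleR_left_commute)
  ultimately show ?thesis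
    using assms by (auto simp: disc_def vimage_def)
qed

text \<open>The witness is the intersection of a convex open neighbourhood with its reflection.\<close>

lemma locally_convex_space_disc:
  assumes T: "locally_convex_space T" "topspace T = UNIV" and "openin T U" "0 \<in> U"
  obtains V where "openin T V" "0 \<in> V" "disc V" "V \<subseteq> U"
proof -
  have tvs: "topological_vector_space T"
    using T by (simp add: locally_convex_space_def)
  obtain V where V: "openin T V" "0 \<in> V" "convex V" "V \<subseteq> U"
    using assms unfolding locally_convex_space_def by blast
  let ?V' = "{v. (-1) *\<^sub>R v \<in> V}"
  have V': "openin T ?V'"
    by (rule openin_scale[OF tvs T(2) V(1)])
  have "convex ((\<lambda>v. (-1) *\<^sub>R v) -` V)"
    using V by (intro convex_linear_vimage) (auto simp: linear_iff)
  then have "convex (V \<inter> ?V')"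
    using V by (intro convex_Int) (auto simp: vimage_def)
  moreover have op: "openin T (V \<inter> ?V')"
    using V V' by blast
  ultimately have "disc (V \<inter> ?V')"
    using openin_absorbing[OF tvs T(2) op] V by (auto simp: disc_def)
  then show ?thesis
    using V op by (intro that[of "V \<inter> ?V'"]) auto
qed

section \<open>Bases of neighbourhood filters\<close>

lemma has_G_base_nhdsinE:
  assumes "has_G_base (nhdsin T p)" "p \<in> topspace T"
  obtains U :: "(nat \<Rightarrow> nat) \<Rightarrow> 'v set" where "\<forall>\<alpha>. \<exists>S. openin T S \<and> p \<in> S \<and> S \<subseteq> U \<alpha>"
    "\<forall>S. openin T S \<and> p \<in> S \<longrightarrow> (\<exists>\<alpha>. U \<alpha> \<subseteq> S)" "\<forall>\<alpha> \<beta>. \<alpha> \<le> \<beta> \<longrightarrow> U \<beta> \<subseteq> U \<alpha>"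
proof -
  obtain U :: "(nat \<Rightarrow> nat) \<Rightarrow> 'v set" where U: "\<forall>\<alpha>. \<forall>\<^sub>F q in nhdsin T p. q \<in> U \<alpha>"
    "\<forall>P. eventually P (nhdsin T p) \<longrightarrow> (\<exists>\<alpha>. \<forall>q\<in>U \<alpha>. P q)" "\<forall>\<alpha> \<beta>. \<alpha> \<le> \<beta> \<longrightarrow> U \<beta> \<subseteq> U \<alpha>"
    using assms(1) unfolding has_G_base_def by (elim exE conjE)
  show ?thesis
  proof (rule that[of U]; intro allI impI; (elim conjE)?)
    show "\<exists>S. openin T S \<and> p \<in> S \<and> S \<subseteq> U \<alpha>" for \<alpha>
      using U(1)[rule_format, of \<alpha>] assms(2) by (auto simp: eventually_nhdsin)
    show "\<exists>\<alpha>. U \<alpha> \<subseteq> S" if "openin T S" "p \<in> S" for S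
    proof -
      have "\<forall>\<^sub>F q in nhdsin T p. q \<in> S"
        using that by (auto simp: eventually_nhdsin)
      from U(2)[rule_format, OF this] show ?thesis by blast
    qed
    show "U \<beta> \<subseteq> U \<alpha>" if "\<alpha> \<le> \<beta>" for \<alpha> \<beta>
      by (rule U(3)[rule_format, OF that])
  qed
qed

lemma has_G_base_nhdsinI:
  fixes U :: "(nat \<Rightarrow> nat) \<Rightarrow> 'v set"
  assumes p: "p \<in> topspace T" and nhd: "\<And>\<alpha>. \<exists>S. openin T S \<and> p \<in> S \<and> S \<subseteq> U \<alpha>"
    and base: "\<And>S. openin T S \<Longrightarrow> p \<in> S \<Longrightarrow> \<exists>\<alpha>. U \<alpha> \<subseteq> S"
    and mono: "\<And>\<alpha> \<beta>. \<alpha> \<le> \<beta> \<Longrightarrow> U \<beta> \<subseteq> U \<alpha>"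
  shows "has_G_base (nhdsin T p)"
  unfolding has_G_base_def
proof (intro exI[of _ U] conjI allI impI)
  show "\<forall>\<^sub>F q in nhdsin T p. q \<in> U \<alpha>" for \<alpha>
    using nhd[of \<alpha>] by (auto simp: eventually_nhdsin)
next
  fix P assume "eventually P (nhdsin T p)"
  then obtain S where S: "openin T S" "p \<in> S" "\<forall>q\<in>S. P q"
    using p by (auto simp: eventually_nhdsin)
  obtain \<alpha> where "U \<alpha> \<subseteq> S"
    using base[OF S(1,2)] by (rule exE)
  then show "\<exists>\<alpha>. \<forall>q\<in>U \<alpha>. P q"
    using S(3) by (intro exI[of _ \<alpha>]) auto
qed (rule mono)

lemma has_local_G_base_translate:
  fixes T :: "'v::real_vector topology"
  assumes tvs: "topological_vector_space T" and UNIV: "topspace T = UNIV"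
    and G: "has_G_base (nhdsin T 0)"
  shows "has_local_G_base T"
  unfolding has_local_G_base_def
proof
  fix p assume p: "p \<in> topspace T"
  have zero: "0 \<in> topspace T"
    using UNIV by simp
  obtain U :: "(nat \<Rightarrow> nat) \<Rightarrow> 'v set" where U: "\<forall>\<alpha>. \<exists>S. openin T S \<and> 0 \<in> S \<and> S \<subseteq> U \<alpha>"
    "\<forall>S. openin T S \<and> 0 \<in> S \<longrightarrow> (\<exists>\<alpha>. U \<alpha> \<subseteq> S)" "\<forall>\<alpha> \<beta>. \<alpha> \<le> \<beta> \<longrightarrow> U \<beta> \<subseteq> U \<alpha>"
    by (rule has_G_base_nhdsinE[OF G zero])
  show "has_G_base (nhdsin T p)"
  proof (rule has_G_base_nhdsinI[OF p, of "\<lambda>\<alpha>. {v. - p + v \<in> U \<alpha>}"])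
    fix \<alpha>
    obtain S where S: "openin T S" "0 \<in> S" "S \<subseteq> U \<alpha>"
      using U(1)[rule_format, of \<alpha>] by blast
    show "\<exists>S. openin T S \<and> p \<in> S \<and> S \<subseteq> {v. - p + v \<in> U \<alpha>}"
      by (rule exI[of _ "{v. - p + v \<in> S}"])
        (use S openin_translate[OF tvs UNIV S(1), of "- p"] in auto)
  next
    fix S assume S: "openin T S" "p \<in> S"
    obtain \<alpha> where \<alpha>: "U \<alpha> \<subseteq> {v. p + v \<in> S}"
      using U(2)[rule_format, of "{v. p + v \<in> S}"] openin_translate[OF tvs UNIV S(1)] S(2) by auto
    have "{v. - p + v \<in> U \<alpha>} \<subseteq> S"
      using \<alpha> by fastforce
    then show "\<exists>\<alpha>. {v. - p + v \<in> U \<alpha>} \<subseteq> S"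
      by (rule exI[of _ \<alpha>])
  next
    fix \<alpha> \<beta> :: "nat \<Rightarrow> nat" assume "\<alpha> \<le> \<beta>"
    then show "{v. - p + v \<in> U \<beta>} \<subseteq> {v. - p + v \<in> U \<alpha>}"
      using U(3)[rule_format, of \<alpha> \<beta>] by auto
  qed
qed

section \<open>Minkowski functionals\<close>

definition minkowski :: "'v::real_vector set \<Rightarrow> 'v \<Rightarrow> real" where
  "minkowski W v = Inf {t. 0 < t \<and> (1/t) *\<^sub>R v \<in> W}"

lemma minkowski_le:
  assumes "0 < t" "(1/t) *\<^sub>R v \<in> W" shows "minkowski W v \<le> t"
  unfolding minkowski_def by (rule cInf_lower) (use assms in \<open>auto intro!: bdd_belowI[of _ 0]\<close>)

lemma minkowski_less:
  assumes "disc W" "minkowski W v < r"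
  obtains t where "0 < t" "t < r" "(1/t) *\<^sub>R v \<in> W"
proof -
  obtain e where "0 < e" "e *\<^sub>R v \<in> W"
    using assms(1) by (auto simp: disc_def)
  then have "1/e \<in> {t. 0 < t \<and> (1/t) *\<^sub>R v \<in> W}" by simp
  then show ?thesis
    using cInf_lessD[of "{t. 0 < t \<and> (1/t) *\<^sub>R v \<in> W}" r] assms(2) that
    unfolding minkowski_def by blast
qed

lemma minkowski_triangle:
  assumes "disc W" shows "minkowski W (u + v) \<le> minkowski W u + minkowski W v"
proof (rule field_le_epsilon)
  fix e :: real assume "0 < e"
  then have "minkowski W u < minkowski W u + e/2" "minkowski W v < minkowski W v + e/2" by auto
  then obtain s t where s: "0 < s" "s < minkowski W u + e/2" "(1/s) *\<^sub>R u \<in> W"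
    and t: "0 < t" "t < minkowski W v + e/2" "(1/t) *\<^sub>R v \<in> W"
    by (elim minkowski_less[OF assms])
  have "(s / (s + t)) *\<^sub>R ((1/s) *\<^sub>R u) + (t / (s + t)) *\<^sub>R ((1/t) *\<^sub>R v) \<in> W"
    by (rule convexD)
      (use assms s t in \<open>auto simp: disc_def simp flip: add_divide_distrib\<close>)
  then have "(1 / (s + t)) *\<^sub>R (u + v) \<in> W"
    using s t by (simp add: scaleR_right_distrib)
  then have "minkowski W (u + v) \<le> s + t"
    by (rule minkowski_le[rotated]) (use s t in simp)
  then show "minkowski W (u + v) \<le> minkowski W u + minkowski W v + e"
    using s t by simp
qed

lemma scaleR_mem_disc_of_minkowski:
  assumes W: "disc W" and "\<bar>c\<bar> * r \<le> 1" "minkowski W v < r"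
  shows "c *\<^sub>R v \<in> W"
proof -
  obtain t where t: "0 < t" "t < r" "(1/t) *\<^sub>R v \<in> W"
    using minkowski_less[OF W assms(3)] .
  have "\<bar>c\<bar> * t \<le> \<bar>c\<bar> * r"
    using t by (intro mult_left_mono) auto
  then have "(c * t) *\<^sub>R ((1/t) *\<^sub>R v) \<in> W"
    using assms t by (intro disc_scaleR[OF W t(3)]) (auto simp: abs_mult)
  then show ?thesis using t by simp
qed

text \<open>
  Adding a constant makes the function strictly larger than the Minkowski functional, so that
  every majorant controls membership in \<open>V\<close> itself and not only in multiples \<open>t V\<close> with \<open>t > 1\<close>.
\<close>

lemma minkowski_in_C_u:
  assumes L: "topological_vector_space L" "topspace L = UNIV" "uniformly_continuous_into L \<delta>"
    and V: "disc V" "openin L V"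
  shows "(\<lambda>x. minkowski V (\<delta> x) + 1) \<in> C_u"
proof (rule C_u_I)
  fix e :: real assume e: "0 < e"
  have "\<forall>\<^sub>F (x, y) in uniformity. \<delta> y - \<delta> x \<in> {v. (1/e) *\<^sub>R v \<in> V}"
    by (rule L(3)[unfolded uniformly_continuous_into_iff, THEN conjunct2, rule_format])
      (use openin_scale[OF L(1,2) V(2)] disc_zero[OF V(1)] in simp)
  then show "\<forall>\<^sub>F (x, y) in uniformity. minkowski V (\<delta> y) + 1 \<le> minkowski V (\<delta> x) + 1 + e"
  proof (rule eventually_mono, clarify)
    fix x y assume "(1/e) *\<^sub>R (\<delta> y - \<delta> x) \<in> V"
    then have "minkowski V (\<delta> y - \<delta> x) \<le> e"
      by (rule minkowski_le[OF e])
    then show "minkowski V (\<delta> y) + 1 \<le> minkowski V (\<delta> x) + 1 + e"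
      using minkowski_triangle[OF V(1), of "\<delta> x" "\<delta> y - \<delta> x"] by simp
  qed
qed

section \<open>The locally convex topology given by a base of discs\<close>

text \<open>
  Closure under \<open>scale\<close> makes the base closed under halving, hence addition continuous, and lets
  it absorb the scalars in a bounded interval.
\<close>

locale disc_base =
  fixes N :: "'v::real_vector set set"
  assumes nonempty: "N \<noteq> {}"
    and disc: "A \<in> N \<Longrightarrow> disc A"
    and directed: "A \<in> N \<Longrightarrow> B \<in> N \<Longrightarrow> \<exists>C\<in>N. C \<subseteq> A \<inter> B"
    and scale: "A \<in> N \<Longrightarrow> 0 < r \<Longrightarrow> \<exists>C\<in>N. \<forall>u\<in>C. r *\<^sub>R u \<in> A"
    and separating: "v \<noteq> 0 \<Longrightarrow> \<exists>A\<in>N. v \<notin> A"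
begin

definition disc_topology :: "'v topology" where
  "disc_topology = topology (\<lambda>S. \<forall>x\<in>S. \<exists>A\<in>N. \<forall>u\<in>A. x + u \<in> S)"

lemma openin_disc_topology:
  "openin disc_topology S \<longleftrightarrow> (\<forall>x\<in>S. \<exists>A\<in>N. \<forall>u\<in>A. x + u \<in> S)"
proof -
  have "istopology (\<lambda>S. \<forall>x\<in>S. \<exists>A\<in>N. \<forall>u\<in>A. x + u \<in> S)"
    unfolding istopology_def
  proof (intro conjI allI impI ballI)
    fix S S' x
    assume "\<forall>x\<in>S. \<exists>A\<in>N. \<forall>u\<in>A. x + u \<in> S" "\<forall>x\<in>S'. \<exists>A\<in>N. \<forall>u\<in>A. x + u \<in> S'" "x \<in> S \<inter> S'"
    then obtain A B where "A \<in> N" "B \<in> N" "\<forall>u\<in>A. x + u \<in> S" "\<forall>u\<in>B. x + u \<in> S'"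
      by blast
    then show "\<exists>A\<in>N. \<forall>u\<in>A. x + u \<in> S \<inter> S'"
      using directed[of A B] by blast
  next
    fix K x
    assume "\<forall>S\<in>K. \<forall>x\<in>S. \<exists>A\<in>N. \<forall>u\<in>A. x + u \<in> S" "x \<in> \<Union>K"
    then show "\<exists>A\<in>N. \<forall>u\<in>A. x + u \<in> \<Union>K"
      by (meson UnionE UnionI)
  qed
  then show ?thesis by (simp add: disc_topology_def)
qed

lemma topspace_disc_topology: "topspace disc_topology = UNIV"
proof -
  have "openin disc_topology UNIV"
    using nonempty by (auto simp: openin_disc_topology)
  then show ?thesis using openin_subset by blast
qed

lemma half:
  assumes "A \<in> N" obtains C where "C \<in> N" "\<And>u v. u \<in> C \<Longrightarrow> v \<in> C \<Longrightarrow> u + v \<in> A"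
proof -
  obtain C where C: "C \<in> N" "\<forall>u\<in>C. 2 *\<^sub>R u \<in> A"
    using scale[OF assms, of 2] by auto
  have "u + v \<in> A" if "u \<in> C" "v \<in> C" for u v
    using disc_add[OF disc[OF assms], of 1 1 u v] C that by simp
  with C show ?thesis by (intro that) auto
qed

text \<open>
  The members of the base need not be open; the interior of such a member is convex, because
  the base consists of convex sets.
\<close>

lemma disc_interior:
  assumes "A \<in> N"
  obtains V where "openin disc_topology V" "0 \<in> V" "convex V" "V \<subseteq> A"
proof
  let ?V = "{x. \<exists>B\<in>N. \<forall>u\<in>B. x + u \<in> A}"
  show "openin disc_topology ?V"
    unfolding openin_disc_topology
  proof safe
    fix x B assume B: "B \<in> N" "\<forall>u\<in>B. x + u \<in> A"
    obtain C where C: "C \<in> N" "\<And>u v. u \<in> C \<Longrightarrow> v \<in> C \<Longrightarrow> u + v \<in> B"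
      using half[OF B(1)] by blast
    have "x + u + v \<in> A" if "u \<in> C" "v \<in> C" for u v
      using B(2) C(2)[OF that] by (simp add: add.assoc)
    then show "\<exists>A'\<in>N. \<forall>u\<in>A'. x + u \<in> ?V"
      using C(1) by blast
  qed
  show "0 \<in> ?V" using assms by auto
  show "?V \<subseteq> A"
  proof safe
    fix x B assume "B \<in> N" "\<forall>u\<in>B. x + u \<in> A"
    then show "x \<in> A"
      using disc_zero[OF disc, of B] by force
  qed
  show "convex ?V"
  proof (rule convexI)
    fix x y and a b :: real
    assume "x \<in> ?V" "y \<in> ?V" and ab: "0 \<le> a" "0 \<le> b" "a + b = 1"
    then obtain B B' where B: "B \<in> N" "B' \<in> N" "\<forall>u\<in>B. x + u \<in> A" "\<forall>u\<in>B'. y + u \<in> A"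
      by blast
    then obtain C where C: "C \<in> N" "\<forall>u\<in>C. x + u \<in> A" "\<forall>u\<in>C. y + u \<in> A"
      using directed[OF B(1,2)] by blast
    have "a *\<^sub>R x + b *\<^sub>R y + u \<in> A" if "u \<in> C" for u
    proof -
      have "a *\<^sub>R (x + u) + b *\<^sub>R (y + u) \<in> A"
        using C that ab disc[OF assms] by (intro convexD) (auto simp: disc_def)
      moreover have "a *\<^sub>R (x + u) + b *\<^sub>R (y + u) = a *\<^sub>R x + b *\<^sub>R y + (a + b) *\<^sub>R u"
        by (simp add: algebra_simps)
      ultimately show ?thesis using ab by simp
    qed
    then show "a *\<^sub>R x + b *\<^sub>R y \<in> ?V" using C(1) by blast
  qed
qed

lemma disc_neighbourhood:
  assumes "A \<in> N"
  obtains V where "openin disc_topology V" "x \<in> V" "\<And>y. y \<in> V \<Longrightarrow> y - x \<in> A"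
proof -
  obtain V where V: "openin disc_topology V" "0 \<in> V" "V \<subseteq> A"
    using disc_interior[OF assms] by blast
  have "openin disc_topology {y. y - x \<in> V}"
    unfolding openin_disc_topology
  proof safe
    fix y assume "y - x \<in> V"
    then obtain B where B: "B \<in> N" "\<forall>u\<in>B. y - x + u \<in> V"
      using V(1) unfolding openin_disc_topology by blast
    then show "\<exists>B\<in>N. \<forall>u\<in>B. y + u \<in> {y. y - x \<in> V}"
      by (intro bexI[OF _ B(1)]) (simp add: algebra_simps)
  qed
  then show ?thesis
    using V by (intro that[of "{y. y - x \<in> V}"]) auto
qed

lemma locally_convex_space_disc_topology: "locally_convex_space disc_topology"
proof -
  let ?T = disc_topology
  have "Hausdorff_space ?T"
    unfolding Hausdorff_space_def
  proof (intro allI impI; elim conjE)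
    fix x y :: 'v assume "x \<noteq> y"
    then obtain A where A: "A \<in> N" "y - x \<notin> A"
      using separating[of "y - x"] by auto
    obtain C where C: "C \<in> N" "\<And>u v. u \<in> C \<Longrightarrow> v \<in> C \<Longrightarrow> u + v \<in> A"
      using half[OF A(1)] by blast
    obtain U V where U: "openin ?T U" "x \<in> U" "\<And>z. z \<in> U \<Longrightarrow> z - x \<in> C"
      and V: "openin ?T V" "y \<in> V" "\<And>z. z \<in> V \<Longrightarrow> z - y \<in> C"
      using disc_neighbourhood[OF C(1), of x] disc_neighbourhood[OF C(1), of y] by metis
    have "z \<notin> V" if "z \<in> U" for z
    proof
      assume "z \<in> V"
      then have "- (z - y) \<in> C"
        using V(3) disc[OF C(1)] unfolding disc_def by blast
      then have "(z - x) + - (z - y) \<in> A"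
        using U(3)[OF that] C(2) by blast
      then show False using A(2) by simp
    qed
    then show "\<exists>U V. openin ?T U \<and> openin ?T V \<and> x \<in> U \<and> y \<in> V \<and> disjnt U V"
      using U V by (auto simp: disjnt_iff)
  qed
  moreover have "continuous_map (prod_topology ?T ?T) ?T (\<lambda>(u, v). u + v)"
    unfolding continuous_map_def topspace_prod_topology topspace_disc_topology
  proof (intro conjI allI impI)
    fix S assume S: "openin ?T S"
    have "\<exists>U V. openin ?T U \<and> openin ?T V \<and> x \<in> U \<and> y \<in> V \<and>
        U \<times> V \<subseteq> {p \<in> UNIV \<times> UNIV. (case p of (u, v) \<Rightarrow> u + v) \<in> S}"
      if xy: "x + y \<in> S" for x y
    proof -
      obtain A where A: "A \<in> N" "\<forall>u\<in>A. x + y + u \<in> S"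
        using S xy unfolding openin_disc_topology by blast
      obtain C where C: "C \<in> N" "\<And>u v. u \<in> C \<Longrightarrow> v \<in> C \<Longrightarrow> u + v \<in> A"
        using half[OF A(1)] by blast
      obtain U V where U: "openin ?T U" "x \<in> U" "\<And>z. z \<in> U \<Longrightarrow> z - x \<in> C"
        and V: "openin ?T V" "y \<in> V" "\<And>z. z \<in> V \<Longrightarrow> z - y \<in> C"
        using disc_neighbourhood[OF C(1), of x] disc_neighbourhood[OF C(1), of y] by metis
      have "u + v \<in> S" if "u \<in> U" "v \<in> V" for u v
      proof -
        have "x + y + ((u - x) + (v - y)) \<in> S"
          using A(2) C(2) U(3) V(3) that by blast
        then show ?thesis by (simp add: algebra_simps)
      qed
      then show ?thesis using U V by (intro exI[of _ U] exI[of _ V]) auto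
    qed
    then show "openin (prod_topology ?T ?T)
        {p \<in> UNIV \<times> UNIV. (case p of (u, v) \<Rightarrow> u + v) \<in> S}"
      unfolding openin_prod_topology_alt by auto
  qed auto
  moreover have "continuous_map (prod_topology euclideanreal ?T) ?T (\<lambda>(c, v). c *\<^sub>R v)"
    unfolding continuous_map_def topspace_prod_topology topspace_disc_topology
  proof (intro conjI allI impI)
    fix S assume S: "openin ?T S"
    \<comment> \<open>The increment of the product is \<open>b v - c x = (b - c) x + b (v - x)\<close>, and \<open>M\<close> bounds \<open>b\<close>.\<close>
    have "\<exists>U V. openin euclideanreal U \<and> openin ?T V \<and> c \<in> U \<and> x \<in> V \<and>
        U \<times> V \<subseteq> {p \<in> topspace euclideanreal \<times> UNIV. (case p of (c, v) \<Rightarrow> c *\<^sub>R v) \<in> S}"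
      if cx: "c *\<^sub>R x \<in> S" for c x
    proof -
      obtain A where A: "A \<in> N" "\<forall>u\<in>A. c *\<^sub>R x + u \<in> S"
        using S cx unfolding openin_disc_topology by blast
      obtain C where C: "C \<in> N" "\<And>u v. u \<in> C \<Longrightarrow> v \<in> C \<Longrightarrow> u + v \<in> A"
        using half[OF A(1)] by blast
      obtain e where e: "0 < e" "e *\<^sub>R x \<in> C"
        using disc[OF C(1)] by (auto simp: disc_def)
      define M where "M = \<bar>c\<bar> + e"
      have M: "0 < M" using e by (simp add: M_def)
      obtain D where D: "D \<in> N" "\<forall>u\<in>D. M *\<^sub>R u \<in> C"
        using scale[OF C(1) M] by blast
      obtain V where V: "openin ?T V" "x \<in> V" "\<And>z. z \<in> V \<Longrightarrow> z - x \<in> D"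
        using disc_neighbourhood[OF D(1), of x] by blast
      have "b *\<^sub>R v \<in> S" if "b \<in> ball c e" "v \<in> V" for b v
      proof -
        have b: "\<bar>b - c\<bar> < e" using that by (simp add: dist_real_def abs_minus_commute)
        have "((b - c) / e) *\<^sub>R (e *\<^sub>R x) \<in> C"
          by (rule disc_scaleR[OF disc[OF C(1)] e(2)]) (use b e in auto)
        then have 1: "(b - c) *\<^sub>R x \<in> C" using e by simp
        have "(b / M) *\<^sub>R (M *\<^sub>R (v - x)) \<in> C"
          by (rule disc_scaleR[OF disc[OF C(1)]]) (use b M D V(3) that in \<open>auto simp: M_def\<close>)
        then have 2: "b *\<^sub>R (v - x) \<in> C" using M by simp
        have "c *\<^sub>R x + ((b - c) *\<^sub>R x + b *\<^sub>R (v - x)) \<in> S"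
          using A(2) C(2)[OF 1 2] by blast
        then show ?thesis by (simp add: algebra_simps)
      qed
      then show ?thesis
        using V e by (intro exI[of _ "ball c e"] exI[of _ V]) auto
    qed
    then show "openin (prod_topology euclideanreal ?T)
        {p \<in> topspace euclideanreal \<times> UNIV. (case p of (c, v) \<Rightarrow> c *\<^sub>R v) \<in> S}"
      unfolding openin_prod_topology_alt by auto
  qed auto
  moreover have "\<exists>V. openin ?T V \<and> 0 \<in> V \<and> convex V \<and> V \<subseteq> U" if U: "openin ?T U" "0 \<in> U" for U
  proof -
    obtain A where A: "A \<in> N" "A \<subseteq> U"
      using U unfolding openin_disc_topology by fastforce
    then show ?thesis using disc_interior[OF A(1)] by (metis order_trans)
  qed
  ultimately show ?thesis
    by (simp add: locally_convex_space_def topological_vector_space_def topspace_disc_topology)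
qed

end

section \<open>Neighbourhoods of zero in a free locally convex space\<close>

text \<open>
  The topology of a free locally convex space is the finest locally convex one for which \<open>\<delta>\<close> is
  uniformly continuous.  Refining it by the multiples of \<open>W\<close> keeps \<open>\<delta>\<close> uniformly continuous, so the
  universal property makes the identity continuous into the refinement.
\<close>

lemma free_lcs_disc_neighbourhood:
  fixes L :: "'l::real_vector topology" and \<delta> :: "'a::uniform_space \<Rightarrow> 'l"
  assumes free: "free_locally_convex_space L \<delta>" and W: "disc W"
    and ent: "\<And>r. 0 < r \<Longrightarrow> \<forall>\<^sub>F (x, y) in uniformity. r *\<^sub>R (\<delta> y - \<delta> x) \<in> W"
  obtains V where "openin L V" "0 \<in> V" "V \<subseteq> W"
proof -
  have L: "locally_convex_space L" "topspace L = UNIV" "uniformly_continuous_into L \<delta>"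
    and univ: "universal_for TYPE('l) L \<delta>"
    using free by (auto simp: free_locally_convex_space_def)
  have tvs: "topological_vector_space L"
    using L by (simp add: locally_convex_space_def)
  define N where "N = {U \<inter> {v. r *\<^sub>R v \<in> W} |U r. openin L U \<and> 0 \<in> U \<and> disc U \<and> 0 < r}"
  have N_I: "U \<inter> {v. r *\<^sub>R v \<in> W} \<in> N" if "openin L U" "0 \<in> U" "disc U" "0 < r" for U r
    using that by (auto simp: N_def)
  have disc_UNIV: "disc (UNIV :: 'l set)"
    by (auto simp: disc_def intro: exI[of _ 1])
  have openin_UNIV: "openin L UNIV"
    using L(2) openin_topspace[of L] by simp
  interpret disc_base N
  proof
    show "N \<noteq> {}"
      using N_I[OF openin_UNIV _ disc_UNIV, of 1] by auto
    show "disc A" if "A \<in> N" for A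
      using that W by (auto simp: N_def intro: disc_Int disc_scaleR_vimage)
  next
    fix A B assume "A \<in> N" "B \<in> N"
    then obtain U r U' r' where U: "openin L U" "0 \<in> U" "disc U" "0 < r" "A = U \<inter> {v. r *\<^sub>R v \<in> W}"
      and U': "openin L U'" "0 \<in> U'" "disc U'" "0 < r'" "B = U' \<inter> {v. r' *\<^sub>R v \<in> W}"
      unfolding N_def by blast
    have "r *\<^sub>R v \<in> W \<and> r' *\<^sub>R v \<in> W" if "max r r' *\<^sub>R v \<in> W" for v
    proof -
      have "(r / max r r') *\<^sub>R (max r r' *\<^sub>R v) \<in> W" "(r' / max r r') *\<^sub>R (max r r' *\<^sub>R v) \<in> W"
        by (rule disc_scaleR[OF W that]; use U U' in \<open>simp add: divide_simps\<close>)+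
      then show ?thesis using U(4) U'(4) by auto
    qed
    then have "U \<inter> U' \<inter> {v. max r r' *\<^sub>R v \<in> W} \<subseteq> A \<inter> B"
      using U(5) U'(5) by blast
    moreover have "U \<inter> U' \<inter> {v. max r r' *\<^sub>R v \<in> W} \<in> N"
      by (rule N_I) (use U U' in \<open>auto intro: disc_Int\<close>)
    ultimately show "\<exists>C\<in>N. C \<subseteq> A \<inter> B" by blast
  next
    fix A and s :: real assume "A \<in> N" and s: "0 < s"
    then obtain U r where U: "openin L U" "0 \<in> U" "disc U" "0 < r" "A = U \<inter> {v. r *\<^sub>R v \<in> W}"
      unfolding N_def by blast
    have "{v. s *\<^sub>R v \<in> U} \<inter> {v. (r * s) *\<^sub>R v \<in> W} \<in> N"
      by (rule N_I)
        (use U s openin_scale[OF tvs L(2) U(1)] in \<open>simp_all add: disc_scaleR_vimage\<close>)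
    then show "\<exists>C\<in>N. \<forall>u\<in>C. s *\<^sub>R u \<in> A"
      by (rule bexI[rotated]) (use U(5) in simp)
  next
    fix v :: 'l assume "v \<noteq> 0"
    moreover have "Hausdorff_space L" using tvs by (simp add: topological_vector_space_def)
    ultimately obtain U where U: "openin L U" "0 \<in> U" "v \<notin> U"
      using L(2) unfolding Hausdorff_space_def disjnt_iff by (metis UNIV_I)
    obtain V where V: "openin L V" "0 \<in> V" "disc V" "V \<subseteq> U"
      using locally_convex_space_disc[OF L(1,2) U(1,2)] .
    then show "\<exists>A\<in>N. v \<notin> A"
      using U(3) N_I[of V 1] by (intro bexI[of _ "V \<inter> {v. 1 *\<^sub>R v \<in> W}"]) auto
  qed
  have "uniformly_continuous_into disc_topology \<delta>"
    unfolding uniformly_continuous_into_iff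
  proof safe
    fix S assume S: "openin disc_topology S" "0 \<in> S"
    then obtain A where A: "A \<in> N" "A \<subseteq> S"
      unfolding openin_disc_topology by fastforce
    then obtain U r where U: "openin L U" "0 \<in> U" "0 < r" "A = U \<inter> {v. r *\<^sub>R v \<in> W}"
      unfolding N_def by blast
    have "\<forall>\<^sub>F (x, y) in uniformity. \<delta> y - \<delta> x \<in> U"
      using L(3) U unfolding uniformly_continuous_into_iff by blast
    with ent[OF U(3)] show "\<forall>\<^sub>F (x, y) in uniformity. \<delta> y - \<delta> x \<in> S"
      by eventually_elim (use A U in auto)
  qed (simp add: topspace_disc_topology)
  then obtain g where g: "linear g" "continuous_map L disc_topology g" "g \<circ> \<delta> = \<delta>"
    using univ locally_convex_space_disc_topology unfolding universal_for_def by blast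
  have "g v = id v" for v
    by (rule linear_eq_on_span[OF g(1) linear_id, of "range \<delta>"])
      (use g(3) free_lcs_span[OF free] in \<open>auto simp: fun_eq_iff\<close>)
  then have cont: "continuous_map L disc_topology id"
    using g(2) by (metis ext)
  obtain V where V: "openin disc_topology V" "0 \<in> V" "V \<subseteq> UNIV \<inter> {v. 1 *\<^sub>R v \<in> W}"
    using disc_interior[OF N_I[OF openin_UNIV _ disc_UNIV, of 1]] by auto
  moreover have "openin L V"
    using openin_continuous_map_preimage[OF cont V(1)] L(2) by simp
  ultimately show ?thesis by (intro that) auto
qed

section \<open>From a local base to domination\<close>

text \<open>
  Neighbourhoods of zero recover the uniformity: a bounded uniformly continuous pseudometric \<open>d\<close>
  gives the Kuratowski map \<open>x \<mapsto> d x\<close> into the Banach space of bounded continuous functions.  It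
  extends linearly to \<open>L\<close>, and the preimage of the ball of radius 1/2 forces \<open>d x y < 1/2\<close>.
\<close>

lemma free_lcs_entourage:
  fixes L :: "'l::real_vector topology" and \<delta> :: "'a::uniform_space \<Rightarrow> 'l"
  assumes free: "free_locally_convex_space L \<delta>" and D: "\<forall>\<^sub>F p in uniformity. p \<in> D"
  obtains U where "openin L U" "0 \<in> U" "\<And>x y. \<delta> y - \<delta> x \<in> U \<Longrightarrow> (x, y) \<in> D"
proof -
  obtain d :: "'a \<Rightarrow> 'a \<Rightarrow> real" where
    d: "\<And>x. d x x = 0" "\<And>x y. 0 \<le> d x y" "\<And>x y. d x y \<le> 2" "\<And>x y. d x y = d y x"
      "\<And>x y z. d x z \<le> d x y + d y z"
    and small: "\<And>e. 0 < e \<Longrightarrow> \<forall>\<^sub>F (x, y) in uniformity. d x y < e"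
    and D: "\<And>x y. d x y < 1/2 \<Longrightarrow> (x, y) \<in> D"
    using uniform_pseudometric[OF D] by blast
  have lip: "\<bar>d x a - d y a\<bar> \<le> d x y" for x y a
    using d(5)[of x a y] d(5)[of y a x] d(4)[of x y] by simp
  have "d x \<in> C_u" for x
  proof (rule C_u_I)
    fix e :: real assume "0 < e"
    from small[OF this] show "\<forall>\<^sub>F (a, b) in uniformity. d x b \<le> d x a + e"
    proof (rule eventually_mono, clarify)
      fix a b assume "d a b < e"
      then show "d x b \<le> d x a + e"
        using d(5)[of x b a] by simp
    qed
  qed
  then have "continuous_on UNIV (d x)" for x
    unfolding C_u_def by (auto intro: uniformly_continuous_imp_continuous)
  then have bcont: "d x \<in> bcontfun" for x
    by (rule bcontfun_normI[of _ 2]) (use d(2,3) in simp)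
  define \<Phi> where "\<Phi> x = Bcontfun (d x)" for x
  have \<Phi>: "apply_bcontfun (\<Phi> x) = d x" for x
    by (simp add: \<Phi>_def Bcontfun_inverse[OF bcont])
  have "norm (\<Phi> y - \<Phi> x) \<le> d x y" for x y
    by (rule norm_bound) (use lip[of y _ x] d(4)[of x y] in \<open>simp add: \<Phi>\<close>)
  then have "\<forall>\<^sub>F (x, y) in uniformity. norm (\<Phi> y - \<Phi> x) < e" if "0 < e" for e
    by (intro eventually_mono[OF small[OF that]]) (auto intro: le_less_trans)
  then have "uniformly_continuous_into euclidean \<Phi>"
    by (rule uniformly_continuous_into_euclidean)
  then obtain g where g: "linear g" "continuous_map L euclidean g" "g \<circ> \<delta> = \<Phi>"
    using free_lcs_universal[OF free, where ?'z = "'a \<Rightarrow>\<^sub>C real"]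
      locally_convex_space_euclidean[where ?'v = "'a \<Rightarrow>\<^sub>C real"]
    unfolding universal_for_def by blast
  have UNIV: "topspace L = UNIV"
    using free by (simp add: free_locally_convex_space_def)
  show ?thesis
  proof (rule that[of "{v. g v \<in> ball 0 (1/2)}"])
    show "openin L {v. g v \<in> ball 0 (1/2)}"
      using openin_continuous_map_preimage[OF g(2), of "ball 0 (1/2)"] UNIV by simp
    show "0 \<in> {v. g v \<in> ball 0 (1/2)}"
      using linear_0[OF g(1)] by simp
    fix x y assume "\<delta> y - \<delta> x \<in> {v. g v \<in> ball 0 (1/2)}"
    then have "norm (\<Phi> y - \<Phi> x) < 1/2"
      using g(1) fun_cong[OF g(3), of x] fun_cong[OF g(3), of y] by (simp add: linear_diff)
    moreover have "norm (apply_bcontfun (\<Phi> y - \<Phi> x) x) \<le> norm (\<Phi> y - \<Phi> x)"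
      by (rule norm_bounded)
    ultimately have "d x y < 1/2"
      using d(1)[of x] d(2)[of y x] d(4)[of x y] by (simp add: \<Phi>)
    then show "(x, y) \<in> D" by (rule D)
  qed
qed

lemma free_lcs_local_G_base_imp_uniformity:
  fixes L :: "'l::real_vector topology" and \<delta> :: "'a::uniform_space \<Rightarrow> 'l"
  assumes free: "free_locally_convex_space L \<delta>" and G: "has_G_base (nhdsin L 0)"
  shows "has_G_base (uniformity :: ('a \<times> 'a) filter)"
proof -
  have L: "topspace L = UNIV" "uniformly_continuous_into L \<delta>"
    using free by (auto simp: free_locally_convex_space_def)
  have zero: "0 \<in> topspace L"
    using L(1) by simp
  obtain U :: "(nat \<Rightarrow> nat) \<Rightarrow> 'l set" where U: "\<forall>\<alpha>. \<exists>S. openin L S \<and> 0 \<in> S \<and> S \<subseteq> U \<alpha>"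
    "\<forall>S. openin L S \<and> 0 \<in> S \<longrightarrow> (\<exists>\<alpha>. U \<alpha> \<subseteq> S)" "\<forall>\<alpha> \<beta>. \<alpha> \<le> \<beta> \<longrightarrow> U \<beta> \<subseteq> U \<alpha>"
    by (rule has_G_base_nhdsinE[OF G zero])
  show ?thesis
    unfolding has_G_base_def
  proof (intro exI[of _ "\<lambda>\<alpha>. {(x, y). \<delta> y - \<delta> x \<in> U \<alpha>}"] conjI allI impI)
    fix \<alpha>
    obtain S where S: "openin L S" "0 \<in> S" "S \<subseteq> U \<alpha>"
      using U(1)[rule_format, of \<alpha>] by blast
    then have "\<forall>\<^sub>F (x, y) in uniformity. \<delta> y - \<delta> x \<in> S"
      using L(2) unfolding uniformly_continuous_into_iff by blast
    then show "\<forall>\<^sub>F p in uniformity. p \<in> {(x, y). \<delta> y - \<delta> x \<in> U \<alpha>}"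
      by (rule eventually_mono) (use S in auto)
  next
    fix P :: "'a \<times> 'a \<Rightarrow> bool" assume "eventually P uniformity"
    then obtain S where "openin L S" "0 \<in> S" "\<And>x y. \<delta> y - \<delta> x \<in> S \<Longrightarrow> (x, y) \<in> {p. P p}"
      using free_lcs_entourage[OF free, of "{p. P p}"] by auto
    then show "\<exists>\<alpha>. \<forall>p\<in>{(x, y). \<delta> y - \<delta> x \<in> U \<alpha>}. P p"
      using U(2)[rule_format, of S] by blast
  next
    fix \<alpha> \<beta> :: "nat \<Rightarrow> nat" assume "\<alpha> \<le> \<beta>"
    then show "{(x, y). \<delta> y - \<delta> x \<in> U \<beta>} \<subseteq> {(x, y). \<delta> y - \<delta> x \<in> U \<alpha>}"
      using U(3)[rule_format, of \<alpha> \<beta>] by blast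
  qed
qed

text \<open>
  The dominating function with index \<open>\<alpha>\<close> is the support function of the polar \<open>K \<alpha>\<close> of \<open>U \<alpha>\<close>,
  composed with \<open>\<delta>\<close>.  It is finite because \<open>U \<alpha>\<close> is absorbing, uniformly continuous because the
  polar is equicontinuous, and increasing because polars reverse inclusions.  A function in \<open>C_u\<close>
  extends to a continuous functional, which lies in some polar.
\<close>

lemma free_lcs_local_G_base_imp_dominated:
  fixes L :: "'l::real_vector topology" and \<delta> :: "'a::uniform_space \<Rightarrow> 'l"
  assumes free: "free_locally_convex_space L \<delta>" and G: "has_G_base (nhdsin L 0)"
  shows "omega_dominated (C_u :: ('a \<Rightarrow> real) set)"
proof -
  have L: "topspace L = UNIV" "uniformly_continuous_into L \<delta>" "topological_vector_space L"
    using free by (auto simp: free_locally_convex_space_def locally_convex_space_def)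
  have zero: "0 \<in> topspace L"
    using L(1) by simp
  obtain U :: "(nat \<Rightarrow> nat) \<Rightarrow> 'l set" where U: "\<forall>\<alpha>. \<exists>S. openin L S \<and> 0 \<in> S \<and> S \<subseteq> U \<alpha>"
    "\<forall>S. openin L S \<and> 0 \<in> S \<longrightarrow> (\<exists>\<alpha>. U \<alpha> \<subseteq> S)" "\<forall>\<alpha> \<beta>. \<alpha> \<le> \<beta> \<longrightarrow> U \<beta> \<subseteq> U \<alpha>"
    by (rule has_G_base_nhdsinE[OF G zero])
  define K where "K \<alpha> = {g :: 'l \<Rightarrow> real. linear g \<and> (\<forall>u\<in>U \<alpha>. g u \<le> 1)}" for \<alpha>
  define \<phi> where "\<phi> \<alpha> x = Sup ((\<lambda>g. g (\<delta> x)) ` K \<alpha>)" for \<alpha> x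
  have "(\<lambda>_. 0) \<in> K \<alpha>" for \<alpha>
    by (simp add: K_def linear_iff)
  then have ne: "K \<alpha> \<noteq> {}" for \<alpha>
    by blast
  have bound: "g v \<le> e" if "g \<in> K \<alpha>" "0 < e" "(1/e) *\<^sub>R v \<in> U \<alpha>" for g v e \<alpha>
  proof -
    have "g ((1/e) *\<^sub>R v) \<le> 1" "linear g"
      using that by (auto simp: K_def)
    then show ?thesis using that(2) by (simp add: linear_scale field_simps)
  qed
  have bdd: "bdd_above ((\<lambda>g. g (\<delta> x)) ` K \<alpha>)" for x \<alpha>
  proof -
    obtain S where S: "openin L S" "0 \<in> S" "S \<subseteq> U \<alpha>"
      using U(1)[rule_format, of \<alpha>] by blast
    obtain e where e: "0 < e" "e *\<^sub>R \<delta> x \<in> S"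
      using openin_absorbing[OF L(3,1) S(1,2)] by blast
    have "g (\<delta> x) \<le> 1/e" if "g \<in> K \<alpha>" for g
      by (rule bound[OF that]) (use e S in auto)
    then show ?thesis by (rule bdd_aboveI2)
  qed
  have upper: "g (\<delta> x) \<le> \<phi> \<alpha> x" if "g \<in> K \<alpha>" for g x \<alpha>
    unfolding \<phi>_def by (rule cSUP_upper[OF that bdd])
  have least: "\<phi> \<alpha> x \<le> b" if "\<And>g. g \<in> K \<alpha> \<Longrightarrow> g (\<delta> x) \<le> b" for x \<alpha> b
    unfolding \<phi>_def by (rule cSUP_least[OF ne that])
  show ?thesis
    unfolding omega_dominated_in_def
  proof (intro exI[of _ \<phi>] conjI allI ballI impI)
    fix \<alpha>
    show "\<phi> \<alpha> \<in> C_u"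
    proof (rule C_u_I)
      fix e :: real assume e: "0 < e"
      obtain S where S: "openin L S" "0 \<in> S" "S \<subseteq> U \<alpha>"
        using U(1)[rule_format, of \<alpha>] by blast
      have "\<forall>\<^sub>F (x, y) in uniformity. \<delta> y - \<delta> x \<in> {v. (1/e) *\<^sub>R v \<in> S}"
        by (rule L(2)[unfolded uniformly_continuous_into_iff, THEN conjunct2, rule_format])
          (use openin_scale[OF L(3,1) S(1)] S(2) in simp)
      then show "\<forall>\<^sub>F (x, y) in uniformity. \<phi> \<alpha> y \<le> \<phi> \<alpha> x + e"
      proof (rule eventually_mono, clarify)
        fix x y assume xy: "(1/e) *\<^sub>R (\<delta> y - \<delta> x) \<in> S"
        show "\<phi> \<alpha> y \<le> \<phi> \<alpha> x + e"
        proof (rule least)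
          fix g assume g: "g \<in> K \<alpha>"
          then have "g (\<delta> y - \<delta> x) \<le> e"
            by (rule bound) (use xy S e in auto)
          moreover have "g (\<delta> y - \<delta> x) = g (\<delta> y) - g (\<delta> x)"
            using g by (simp add: K_def linear_diff)
          ultimately show "g (\<delta> y) \<le> \<phi> \<alpha> x + e"
            using upper[OF g, of x] by simp
        qed
      qed
    qed
  next
    fix \<alpha> \<beta> :: "nat \<Rightarrow> nat" assume "\<alpha> \<le> \<beta>"
    then have "K \<alpha> \<subseteq> K \<beta>" using U(3)[rule_format, of \<alpha> \<beta>] by (auto simp: K_def)
    then show "\<phi> \<alpha> \<le> \<phi> \<beta>"
      by (intro le_funI least) (auto intro: upper)
  next
    fix f :: "'a \<Rightarrow> real" assume f: "f \<in> C_u"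
    have "uniformly_continuous_into euclidean f"
      by (rule uniformly_continuous_into_euclidean) (use C_u_D[OF f] in simp)
    then obtain g where g: "linear g" "continuous_map L euclideanreal g" "g \<circ> \<delta> = f"
      using free_lcs_universal[OF free, where ?'z = real]
        locally_convex_space_euclidean[where ?'v = real]
      unfolding universal_for_def by blast
    have "openin L {v. g v \<in> {..<1}}"
      using openin_continuous_map_preimage[OF g(2), of "{..<1}"] L(1) by simp
    then obtain \<alpha> where "U \<alpha> \<subseteq> {v. g v \<in> {..<1}}"
      using U(2)[rule_format, of "{v. g v \<in> {..<1}}"] linear_0[OF g(1)] by auto
    then have "g \<in> K \<alpha>"
      using g(1) by (force simp: K_def)
    then have "f \<le> \<phi> \<alpha>"
      using upper[of g \<alpha>] g(3) by (auto simp: le_fun_def)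
    then show "\<exists>\<alpha>. f \<le> \<phi> \<alpha>" by (rule exI[of _ \<alpha>])
  qed
qed

section \<open>From domination to a local base\<close>

text \<open>
  The vectors absorbed by an absolutely convex set form a subspace, so it is enough to absorb a
  spanning set.
\<close>

lemma disc_of_spanning:
  assumes conv: "convex W" and sym: "\<And>v. v \<in> W \<Longrightarrow> - v \<in> W" and "0 \<in> W"
    and span: "span B = UNIV" and B: "\<And>b. b \<in> B \<Longrightarrow> \<exists>e>0. e *\<^sub>R b \<in> W"
  shows "disc W"
proof -
  have scale: "c *\<^sub>R v \<in> W" if "v \<in> W" "\<bar>c\<bar> \<le> 1" for c v
    using scaleR_mem_symmetric_convex[OF conv sym that] .
  have sub: "subspace {v. \<exists>e>0. e *\<^sub>R v \<in> W}"
    unfolding subspace_def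
  proof (intro conjI ballI allI)
    show "0 \<in> {v. \<exists>e>0. e *\<^sub>R v \<in> W}"
      using \<open>0 \<in> W\<close> by (auto intro: exI[of _ 1])
  next
    fix u v assume "u \<in> {v. \<exists>e>0. e *\<^sub>R v \<in> W}" "v \<in> {v. \<exists>e>0. e *\<^sub>R v \<in> W}"
    then obtain s t where s: "0 < s" "s *\<^sub>R u \<in> W" and t: "0 < t" "t *\<^sub>R v \<in> W"
      by blast
    define m where "m = min s t"
    have m: "0 < m" "m \<le> s" "m \<le> t"
      using s t by (auto simp: m_def)
    have "(m / s) *\<^sub>R (s *\<^sub>R u) \<in> W" "(m / t) *\<^sub>R (t *\<^sub>R v) \<in> W"
      using m s t by (auto intro!: scale simp del: scaleR_scaleR)
    then have "m *\<^sub>R u \<in> W" "m *\<^sub>R v \<in> W"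
      using s t by simp_all
    then have "(1/2) *\<^sub>R (m *\<^sub>R u) + (1/2) *\<^sub>R (m *\<^sub>R v) \<in> W"
      by (rule convexD[OF conv]) auto
    then have "(m/2) *\<^sub>R (u + v) \<in> W"
      by (simp add: scaleR_right_distrib)
    then show "u + v \<in> {v. \<exists>e>0. e *\<^sub>R v \<in> W}"
      using m by (intro CollectI exI[of _ "m/2"]) simp
  next
    fix c :: real and v assume "v \<in> {v. \<exists>e>0. e *\<^sub>R v \<in> W}"
    then obtain e where e: "0 < e" "e *\<^sub>R v \<in> W" by blast
    have "(c / (\<bar>c\<bar> + 1)) *\<^sub>R (e *\<^sub>R v) \<in> W"
      by (rule scale[OF e(2)]) (simp add: divide_simps)
    then have "(e / (\<bar>c\<bar> + 1)) *\<^sub>R (c *\<^sub>R v) \<in> W"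
      by (simp add: mult.commute)
    then show "c *\<^sub>R v \<in> {v. \<exists>e>0. e *\<^sub>R v \<in> W}"
      using e by (intro CollectI exI[of _ "e / (\<bar>c\<bar> + 1)"]) simp
  qed
  have "v \<in> {v. \<exists>e>0. e *\<^sub>R v \<in> W}" for v
    using span_minimal[OF _ sub, of B] B span by blast
  then show ?thesis
    using conv sym by (auto simp: disc_def)
qed

text \<open>
  The disc spanned by the data that determine a neighbourhood of zero: differences of \<open>E n\<close>-close
  generators scaled by \<open>n\<close>, and each generator \<open>\<delta> x\<close> scaled by \<open>1 / f x\<close>.  The scalars are bounded
  by inequalities instead of being prescribed: this makes the generating set symmetric and decreasing
  in \<open>f\<close>, and it gives a meaning to arguments with \<open>f x \<le> 0\<close>, where every scalar is admitted.
\<close>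

definition disc_hull :: "('a \<Rightarrow> 'v::real_vector) \<Rightarrow> (nat \<Rightarrow> ('a \<times> 'a) set) \<Rightarrow> ('a \<Rightarrow> real) \<Rightarrow> 'v set"
  where "disc_hull \<delta> E f = convex hull
    ({c *\<^sub>R (\<delta> y - \<delta> x) |c n x y. (x, y) \<in> E n \<and> \<bar>c\<bar> \<le> real n} \<union> {c *\<^sub>R \<delta> x |c x. \<bar>c\<bar> * f x \<le> 1})"

lemma disc_hull_mono:
  assumes "\<And>n. E n \<subseteq> E' n" "f' \<le> f"
  shows "disc_hull \<delta> E f \<subseteq> disc_hull \<delta> E' f'"
  unfolding disc_hull_def
proof (intro hull_mono Un_mono subsetI)
  fix v assume "v \<in> {c *\<^sub>R \<delta> x |c x. \<bar>c\<bar> * f x \<le> 1}"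
  then obtain c x where v: "v = c *\<^sub>R \<delta> x" "\<bar>c\<bar> * f x \<le> 1" by blast
  have "\<bar>c\<bar> * f' x \<le> \<bar>c\<bar> * f x"
    using assms(2) by (intro mult_left_mono) (auto simp: le_fun_def)
  then have "\<bar>c\<bar> * f' x \<le> 1"
    using v(2) by simp
  then show "v \<in> {c *\<^sub>R \<delta> x |c x. \<bar>c\<bar> * f' x \<le> 1}"
    using v(1) by blast
qed (use assms(1) in blast)

lemma disc_disc_hull:
  assumes "span (range \<delta>) = UNIV" shows "disc (disc_hull \<delta> E f)"
proof -
  let ?G = "{c *\<^sub>R (\<delta> y - \<delta> x) |c n x y. (x, y) \<in> E n \<and> \<bar>c\<bar> \<le> real n} \<union>
    {c *\<^sub>R \<delta> x |c x. \<bar>c\<bar> * f x \<le> 1}"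
  have G: "c *\<^sub>R \<delta> x \<in> disc_hull \<delta> E f" if "\<bar>c\<bar> * f x \<le> 1" for c x
    unfolding disc_hull_def by (rule hull_inc) (use that in blast)
  show ?thesis
  proof (rule disc_of_spanning[OF _ _ _ assms])
    show "convex (disc_hull \<delta> E f)"
      by (simp add: disc_hull_def)
    show "0 \<in> disc_hull \<delta> E f"
      using G[of 0] by simp
  next
    fix v assume "v \<in> disc_hull \<delta> E f"
    then have "- v \<in> uminus ` (convex hull ?G)"
      by (simp add: disc_hull_def)
    also have "uminus ` (convex hull ?G) = convex hull (uminus ` ?G)"
      by (rule convex_hull_linear_image) (simp add: linear_iff)
    also have "\<dots> \<subseteq> convex hull ?G"
    proof (rule hull_mono, rule image_subsetI)
      fix w assume "w \<in> ?G"
      then show "- w \<in> ?G"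
      proof
        assume "w \<in> {c *\<^sub>R (\<delta> y - \<delta> x) |c n x y. (x, y) \<in> E n \<and> \<bar>c\<bar> \<le> real n}"
        then obtain c n x y where "w = c *\<^sub>R (\<delta> y - \<delta> x)" "(x, y) \<in> E n" "\<bar>c\<bar> \<le> real n"
          by blast
        then have "- w = (- c) *\<^sub>R (\<delta> y - \<delta> x)" "(x, y) \<in> E n" "\<bar>- c\<bar> \<le> real n"
          by simp_all
        then show ?thesis by blast
      next
        assume "w \<in> {c *\<^sub>R \<delta> x |c x. \<bar>c\<bar> * f x \<le> 1}"
        then obtain c x where "w = c *\<^sub>R \<delta> x" "\<bar>c\<bar> * f x \<le> 1"
          by blast
        then have "- w = (- c) *\<^sub>R \<delta> x" "\<bar>- c\<bar> * f x \<le> 1"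
          by simp_all
        then show ?thesis by blast
      qed
    qed
    finally show "- v \<in> disc_hull \<delta> E f"
      by (simp add: disc_hull_def)
  next
    fix b assume "b \<in> range \<delta>"
    then obtain x where x: "b = \<delta> x" by blast
    have "\<bar>1 / (\<bar>f x\<bar> + 1)\<bar> * f x = f x / (\<bar>f x\<bar> + 1)"
      by simp
    also have "\<dots> \<le> 1"
      using abs_ge_self[of "f x"] by (subst divide_le_eq_1_pos) linarith+
    finally have "\<bar>1 / (\<bar>f x\<bar> + 1)\<bar> * f x \<le> 1" .
    from G[OF this] show "\<exists>e>0. e *\<^sub>R b \<in> disc_hull \<delta> E f"
      unfolding x by (intro exI[of _ "1 / (\<bar>f x\<bar> + 1)"]) simp
  qed
qed

text \<open>
  The hypotheses survive shrinking \<open>E\<close> and enlarging \<open>f\<close>.  This is why it is enough to let the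
  entourages range over a base of the uniformity and the functions over a dominating family.
\<close>

lemma disc_hull_subset:
  assumes V: "disc V" and E: "\<And>n x y. (x, y) \<in> E n \<Longrightarrow> real n *\<^sub>R (\<delta> y - \<delta> x) \<in> V"
    and f: "\<And>x. minkowski V (\<delta> x) < f x"
  shows "disc_hull \<delta> E f \<subseteq> V"
  unfolding disc_hull_def
proof (rule hull_minimal, safe)
  show "convex V" using V by (simp add: disc_def)
next
  fix c n x y assume xy: "(x, y) \<in> E n" and c: "\<bar>c\<bar> \<le> real n"
  show "c *\<^sub>R (\<delta> y - \<delta> x) \<in> V"
  proof (cases "n = 0")
    case True
    then show ?thesis using c disc_zero[OF V] by simp
  next
    case False
    have "(c / real n) *\<^sub>R (real n *\<^sub>R (\<delta> y - \<delta> x)) \<in> V"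
      by (rule disc_scaleR[OF V E[OF xy]]) (use c False in simp)
    then show ?thesis using False by simp
  qed
next
  fix c x assume "\<bar>c\<bar> * f x \<le> 1"
  then show "c *\<^sub>R \<delta> x \<in> V"
    using scaleR_mem_disc_of_minkowski[OF V _ f] by blast
qed

text \<open>
  A single index codes a sequence of indices, monotonically in each entry; this is the isomorphism
  between the posets of functions on \<open>nat\<close> and of sequences of such functions.
\<close>

definition subindex :: "(nat \<Rightarrow> nat) \<Rightarrow> nat \<Rightarrow> nat \<Rightarrow> nat" where
  "subindex \<alpha> n = (\<lambda>k. \<alpha> (prod_encode (n, k)))"

lemma subindex_mono: "\<alpha> \<le> \<beta> \<Longrightarrow> subindex \<alpha> n \<le> subindex \<beta> n"
  by (simp add: subindex_def le_fun_def)

lemma ex_subindex: "\<exists>\<alpha>. \<forall>n. subindex \<alpha> n = \<beta> n"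
  by (rule exI[of _ "\<lambda>m. case prod_decode m of (n, k) \<Rightarrow> \<beta> n k"]) (simp add: subindex_def)

text \<open>
  Entry 0 of the coded sequence selects the function and entry \<open>n + 1\<close> the entourage \<open>E n\<close> of a disc
  hull.  The hull shrinks as the index grows, because entourages shrink and functions grow.
\<close>

lemma dominated_imp_free_lcs_local_G_base:
  fixes L :: "'l::real_vector topology" and \<delta> :: "'a::uniform_space \<Rightarrow> 'l"
  assumes free: "free_locally_convex_space L \<delta>"
    and G: "has_G_base (uniformity :: ('a \<times> 'a) filter)"
    and dom: "omega_dominated_in (C_u :: ('a \<Rightarrow> real) set) UNIV"
  shows "has_local_G_base L"
proof -
  have L: "locally_convex_space L" "topspace L = UNIV" "uniformly_continuous_into L \<delta>"
    using free by (auto simp: free_locally_convex_space_def)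
  have tvs: "topological_vector_space L"
    using L(1) by (simp add: locally_convex_space_def)
  obtain V :: "(nat \<Rightarrow> nat) \<Rightarrow> ('a \<times> 'a) set" where
    V: "\<forall>\<alpha>. \<forall>\<^sub>F p in uniformity. p \<in> V \<alpha>"
      "\<forall>P. eventually P uniformity \<longrightarrow> (\<exists>\<alpha>. \<forall>p\<in>V \<alpha>. P p)" "\<forall>\<alpha> \<beta>. \<alpha> \<le> \<beta> \<longrightarrow> V \<beta> \<subseteq> V \<alpha>"
    using G unfolding has_G_base_def by (elim exE conjE)
  obtain \<phi> :: "(nat \<Rightarrow> nat) \<Rightarrow> 'a \<Rightarrow> real" where
    \<phi>: "\<forall>\<alpha> \<beta>. \<alpha> \<le> \<beta> \<longrightarrow> \<phi> \<alpha> \<le> \<phi> \<beta>" "\<forall>f\<in>C_u. \<exists>\<alpha>. f \<le> \<phi> \<alpha>"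
    using dom unfolding omega_dominated_in_def by (elim exE conjE)
  define W where "W \<alpha> = disc_hull \<delta> (\<lambda>n. V (subindex \<alpha> (Suc n))) (\<phi> (subindex \<alpha> 0))" for \<alpha>
  have disc_W: "disc (W \<alpha>)" for \<alpha>
    unfolding W_def by (rule disc_disc_hull[OF free_lcs_span[OF free]])
  have "has_G_base (nhdsin L 0)"
  proof (rule has_G_base_nhdsinI[of _ _ W])
    show "0 \<in> topspace L" using L(2) by simp
  next
    fix \<alpha>
    have ent: "\<forall>\<^sub>F (x, y) in uniformity. r *\<^sub>R (\<delta> y - \<delta> x) \<in> W \<alpha>" if r: "0 < r" for r
    proof -
      define n where "n = nat \<lceil>r\<rceil>"
      have n: "\<bar>r\<bar> \<le> real n" using r by (simp add: n_def)
      show ?thesis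
        using V(1)[rule_format, of "subindex \<alpha> (Suc n)"]
      proof (rule eventually_mono, clarify)
        fix x y assume "(x, y) \<in> V (subindex \<alpha> (Suc n))"
        then show "r *\<^sub>R (\<delta> y - \<delta> x) \<in> W \<alpha>"
          unfolding W_def disc_hull_def by (intro hull_inc UnI1) (use n in blast)
      qed
    qed
    obtain S where "openin L S" "0 \<in> S" "S \<subseteq> W \<alpha>"
      using free_lcs_disc_neighbourhood[OF free disc_W ent] .
    then show "\<exists>S. openin L S \<and> 0 \<in> S \<and> S \<subseteq> W \<alpha>" by blast
  next
    fix S assume S: "openin L S" "0 \<in> S"
    obtain D where D: "openin L D" "0 \<in> D" "disc D" "D \<subseteq> S"
      using locally_convex_space_disc[OF L(1,2) S] .
    obtain \<beta>0 where \<beta>0: "(\<lambda>x. minkowski D (\<delta> x) + 1) \<le> \<phi> \<beta>0"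
      using \<phi>(2) minkowski_in_C_u[OF tvs L(2,3) D(3,1)] by (elim ballE exE) auto
    have "\<exists>\<beta>. \<forall>(x, y)\<in>V \<beta>. real n *\<^sub>R (\<delta> y - \<delta> x) \<in> D" for n
    proof -
      have "\<forall>\<^sub>F (x, y) in uniformity. \<delta> y - \<delta> x \<in> {v. real n *\<^sub>R v \<in> D}"
        by (rule L(3)[unfolded uniformly_continuous_into_iff, THEN conjunct2, rule_format])
          (use openin_scale[OF tvs L(2) D(1)] D(2) in simp)
      then show ?thesis
        using V(2)[rule_format, of "\<lambda>(x, y). \<delta> y - \<delta> x \<in> {v. real n *\<^sub>R v \<in> D}"] by simp
    qed
    then obtain \<beta> where \<beta>: "\<And>n. \<forall>(x, y)\<in>V (\<beta> n). real n *\<^sub>R (\<delta> y - \<delta> x) \<in> D"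
      by metis
    obtain \<alpha> where \<alpha>: "\<forall>n. subindex \<alpha> n = (case n of 0 \<Rightarrow> \<beta>0 | Suc m \<Rightarrow> \<beta> m)"
      using ex_subindex[of "\<lambda>n. case n of 0 \<Rightarrow> \<beta>0 | Suc m \<Rightarrow> \<beta> m"] by (rule exE)
    have subindex: "subindex \<alpha> 0 = \<beta>0" "subindex \<alpha> (Suc n) = \<beta> n" for n
      using \<alpha>[rule_format, of 0] \<alpha>[rule_format, of "Suc n"] by simp_all
    have "W \<alpha> \<subseteq> D"
      unfolding W_def subindex
    proof (rule disc_hull_subset[OF D(3)])
      show "real n *\<^sub>R (\<delta> y - \<delta> x) \<in> D" if "(x, y) \<in> V (\<beta> n)" for n x y
        using \<beta>[of n] that by auto
      show "minkowski D (\<delta> x) < \<phi> \<beta>0 x" for x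
        using le_funD[OF \<beta>0, of x] by simp
    qed
    then have "W \<alpha> \<subseteq> S"
      using D(4) by (rule order_trans)
    then show "\<exists>\<alpha>. W \<alpha> \<subseteq> S" by (rule exI[of _ \<alpha>])
  next
    fix \<alpha> \<beta> :: "nat \<Rightarrow> nat" assume "\<alpha> \<le> \<beta>"
    then show "W \<beta> \<subseteq> W \<alpha>"
      unfolding W_def by (intro disc_hull_mono V(3)[rule_format] \<phi>(1)[rule_format] subindex_mono)
  qed
  then show ?thesis
    by (rule has_local_G_base_translate[OF tvs L(2)])
qed

theorem corollary4p4:
  fixes L :: "'l::real_vector topology"
    and \<delta> :: "'a::{uniform_space, t2_space} \<Rightarrow> 'l"
  assumes "free_locally_convex_space L \<delta>"
  shows "(has_local_G_base L \<longleftrightarrow>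
            has_G_base (uniformity :: ('a \<times> 'a) filter) \<and>
            omega_dominated (C_u :: ('a \<Rightarrow> real) set)) \<and>
         (has_G_base (uniformity :: ('a \<times> 'a) filter) \<and>
            omega_dominated (C_u :: ('a \<Rightarrow> real) set) \<longleftrightarrow>
          has_G_base (uniformity :: ('a \<times> 'a) filter) \<and>
            omega_dominated_in (C_u :: ('a \<Rightarrow> real) set) UNIV)"
proof -
  have 12: "has_G_base (uniformity :: ('a \<times> 'a) filter) \<and>
      omega_dominated (C_u :: ('a \<Rightarrow> real) set)" if "has_local_G_base L"
  proof -
    have "has_G_base (nhdsin L 0)"
      using that assms by (simp add: has_local_G_base_def free_locally_convex_space_def)
    then show ?thesis
      using free_lcs_local_G_base_imp_uniformity[OF assms]
        free_lcs_local_G_base_imp_dominated[OF assms] by simp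
  qed
  have 23: "omega_dominated_in (C_u :: ('a \<Rightarrow> real) set) UNIV"
    if "omega_dominated (C_u :: ('a \<Rightarrow> real) set)"
    using that unfolding omega_dominated_in_def by (elim ex_forward) simp
  have 31: "has_local_G_base L" if "has_G_base (uniformity :: ('a \<times> 'a) filter)"
    "omega_dominated_in (C_u :: ('a \<Rightarrow> real) set) UNIV"
    by (rule dominated_imp_free_lcs_local_G_base[OF assms that])
  show ?thesis
    using 12 23 31 by blast
qed

end
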